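(* Fix $\lambda,\kappa\in\mathbf{k}$. The operad $\mathcal{ED}_{\lambda,\kappa}$ of extended dendriform algebras of weight $(\lambda,\kappa)$ is the di-companion $\mathrm{DC}(\mathcal{ERB}_{\lambda,\kappa})$ of the operad $\mathcal{ERB}_{\lambda,\kappa}$ of extended Rota-Baxter algebras of weight $(\lambda,\kappa)$. More precisely, let $V=\mathbf{k}\{\prec,\succ\}$ be the vector space with basis $\{\prec,\succ\}$. For the operad homomorphism $$\Psi:\mathcal{F}(V)\to\mathcal{ERB}_{\lambda,\kappa},\quad \prec\,\mapsto\mu(\mathrm{id}\otimes\rho),\quad \succ\,\mapsto\mu(\rho\otimes\mathrm{id}),$$ we have $\ker\Psi\cap(V^{\otimes 2}\oplus V^{\otimes 2})=\Lambda_{\mathrm{ED},\lambda,\kappa}$.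
   Context: $\mathbf{k}$ is a field of characteristic $0$. All operads are nonsymmetric (ns) operads of $\mathbf{k}$-vector spaces, with partial compositions $\circ_i$ and operadic unit $\mathrm{id}$. $\mathcal{F}(W)$ denotes the free ns operad on a graded vector space $W$; a vector space $V$ of binary operations is placed in arity $2$. Convention: for $V$ in arity $2$, $\mathcal{F}(V)_3=(V\circ_1V)\oplus(V\circ_2V)$ is identified with $V^{\otimes 2}\oplus V^{\otimes 2}$ so that a pair $\big(\sum_i\odot^{(1)}_i\otimes\odot^{(2)}_i,\ \sum_j\odot^{(3)}_j\otimes\odot^{(4)}_j\big)$ represents the relation $\sum_i(x\odot^{(1)}_iy)\odot^{(2)}_iz=\sum_jx\odot^{(3)}_j(y\odot^{(4)}_jz)$, i.e. the element $\sum_i\odot^{(2)}_i\circ_1\odot^{(1)}_i-\sum_j\odot^{(3)}_j\circ_2\odot^{(4)}_j$ of $\mathcal{F}(V)_3$. For a subspace $\Lambda\subseteq V^{\otimes2}\oplus V^{\otimes2}$, $(\Lambda)$ is the operadic ideal it generates and $\mathcal{P}(V,\Lambda):=\mathcal{F}(V)/(\Lambda)$. $\mathcal{ED}_{\lambda,\kappa}:=\mathcal{P}(V,\Lambda_{\mathrm{ED},\lambda,\kappa})$ with $V=\mathbf{k}\{\prec,\succ\}$, $\star=\prec+\succ$, and $\Lambda_{\mathrm{ED},\lambda,\kappa}$ the subspace of all $a(\prec\otimes\prec,\ \prec\otimes\star)+b(\succ\otimes\prec,\ \succ\otimes\prec)+c(\star\otimes\succ,\ \succ\otimes\succ)$ with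 $a,b,c\in\mathbf{k}$ satisfying $\lambda a=\lambda c=0$ and $\kappa(a-c)=0$. $\mathcal{ERB}_{\lambda,\kappa}$ is the quotient of the free ns operad on a unary generator $\rho$ and a binary generator $\mu$ by the operadic ideal generated by the associativity relation $\mu\circ_1\mu-\mu\circ_2\mu$ and $\mu(\rho\otimes\rho)-\rho(\mu(\mathrm{id}\otimes\rho))-\rho(\mu(\rho\otimes\mathrm{id}))-\lambda\rho(\mu(\mathrm{id}\otimes\mathrm{id}))-\kappa\mu(\mathrm{id}\otimes\mathrm{id})$. Here $\mu(\mathrm{id}\otimes\rho)=\mu\circ_2\rho$, $\mu(\rho\otimes\mathrm{id})=\mu\circ_1\rho$. Di-companion: for an ns operad $\mathcal{Q}$ presented by one unary generator $\rho$ and one binary generator $\mu$, let $V=\mathbf{k}\{\prec,\succ\}$ in arity $2$ and let $\Psi_{\mathcal{Q}}:\mathcal{F}(V)\to\mathcal{Q}$ be the operad homomorphism with $\prec\,\mapsto\mu(\mathrm{id}\otimes\rho)$, $\succ\,\mapsto\mu(\rho\otimes\mathrm{id})$. The di-companion of $\mathcal{Q}$ is $\mathrm{DC}(\mathcal{Q}):=\mathcal{F}(V)/\big(\ker\Psi_{\mathcal{Q}}\cap(V^{\otimes2}\oplus V^{\otimes2})\big)$. *)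

theory Defs
  imports
    "HOL-Algebra.AbelCoset"
    "HOL-Algebra.Module"
    "HOL-Algebra.Algebraic_Closure_Type"
    "HOL-Library.Poly_Mapping"
    "HOL-Library.Product_Plus"
begin

section \<open>Nonsymmetric operads\<close>

text \<open>
  The component of arity \<open>n\<close> is a module in the sense of HOL-Algebra; its multiplicative
  fields (inherited from the record of rings) are irrelevant.  \<open>pcomp P m n i x y\<close> is the partial
  composition of \<open>x\<close> in arity \<open>m\<close> with \<open>y\<close> in arity \<open>n\<close> at position \<open>i\<close>, for \<open>1 \<le> i \<le> m\<close>.
\<close>

record ('k, 'a) ns_operad =
  component :: "nat \<Rightarrow> ('k, 'a) module"
  pcomp :: "nat \<Rightarrow> nat \<Rightarrow> nat \<Rightarrow> 'a \<Rightarrow> 'a \<Rightarrow> 'a"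
  op_id :: "'a"

locale ns_operad =
  fixes P :: "('k::field, 'a) ns_operad"
  assumes component_module: "module ring_of_type_algebra (component P n)"
    and op_id_closed: "op_id P \<in> carrier (component P 1)"
    and pcomp_closed:
      "\<lbrakk>1 \<le> i; i \<le> m; x \<in> carrier (component P m); y \<in> carrier (component P n)\<rbrakk>
        \<Longrightarrow> pcomp P m n i x y \<in> carrier (component P (m + n - 1))"
    and pcomp_add_left:
      "\<lbrakk>1 \<le> i; i \<le> m; x \<in> carrier (component P m); x' \<in> carrier (component P m);
        y \<in> carrier (component P n)\<rbrakk>
        \<Longrightarrow> pcomp P m n i (x \<oplus>\<^bsub>component P m\<^esub> x') y =
            pcomp P m n i x y \<oplus>\<^bsub>component P (m + n - 1)\<^esub> pcomp P m n i x' y"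
    and pcomp_smult_left:
      "\<lbrakk>1 \<le> i; i \<le> m; x \<in> carrier (component P m); y \<in> carrier (component P n)\<rbrakk>
        \<Longrightarrow> pcomp P m n i (c \<odot>\<^bsub>component P m\<^esub> x) y = c \<odot>\<^bsub>component P (m + n - 1)\<^esub> pcomp P m n i x y"
    and pcomp_add_right:
      "\<lbrakk>1 \<le> i; i \<le> m; x \<in> carrier (component P m); y \<in> carrier (component P n);
        y' \<in> carrier (component P n)\<rbrakk>
        \<Longrightarrow> pcomp P m n i x (y \<oplus>\<^bsub>component P n\<^esub> y') =
            pcomp P m n i x y \<oplus>\<^bsub>component P (m + n - 1)\<^esub> pcomp P m n i x y'"
    and pcomp_smult_right:
      "\<lbrakk>1 \<le> i; i \<le> m; x \<in> carrier (component P m); y \<in> carrier (component P n)\<rbrakk>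
        \<Longrightarrow> pcomp P m n i x (c \<odot>\<^bsub>component P n\<^esub> y) = c \<odot>\<^bsub>component P (m + n - 1)\<^esub> pcomp P m n i x y"
    and pcomp_id_left:
      "x \<in> carrier (component P n) \<Longrightarrow> pcomp P 1 n 1 (op_id P) x = x"
    and pcomp_id_right:
      "\<lbrakk>1 \<le> i; i \<le> n; x \<in> carrier (component P n)\<rbrakk> \<Longrightarrow> pcomp P n 1 i x (op_id P) = x"
    and pcomp_sequential:
      "\<lbrakk>1 \<le> i; i \<le> l; 1 \<le> j; j \<le> m; x \<in> carrier (component P l); y \<in> carrier (component P m);
        z \<in> carrier (component P n)\<rbrakk>
        \<Longrightarrow> pcomp P (l + m - 1) n (i + j - 1) (pcomp P l m i x y) z =
            pcomp P l (m + n - 1) i x (pcomp P m n j y z)"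
    and pcomp_parallel:
      "\<lbrakk>1 \<le> i; i < k; k \<le> l; x \<in> carrier (component P l); y \<in> carrier (component P m);
        z \<in> carrier (component P n)\<rbrakk>
        \<Longrightarrow> pcomp P (l + m - 1) n (k + m - 1) (pcomp P l m i x y) z =
            pcomp P (l + n - 1) m i (pcomp P l n k x z) y"

definition operad_hom ::
  "('k::field, 'a) ns_operad \<Rightarrow> ('k, 'b) ns_operad \<Rightarrow> (nat \<Rightarrow> 'a \<Rightarrow> 'b) \<Rightarrow> bool" where
  "operad_hom P Q f \<longleftrightarrow>
    (\<forall>n. \<forall>x\<in>carrier (component P n). f n x \<in> carrier (component Q n)) \<and>
    (\<forall>n. \<forall>x\<in>carrier (component P n). \<forall>y\<in>carrier (component P n).
      f n (x \<oplus>\<^bsub>component P n\<^esub> y) = f n x \<oplus>\<^bsub>component Q n\<^esub> f n y) \<and>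
    (\<forall>n c. \<forall>x\<in>carrier (component P n). f n (c \<odot>\<^bsub>component P n\<^esub> x) = c \<odot>\<^bsub>component Q n\<^esub> f n x) \<and>
    f 1 (op_id P) = op_id Q \<and>
    (\<forall>m n i. \<forall>x\<in>carrier (component P m). \<forall>y\<in>carrier (component P n). 1 \<le> i \<longrightarrow> i \<le> m \<longrightarrow>
      f (m + n - 1) (pcomp P m n i x y) = pcomp Q m n i (f m x) (f n y))"


section \<open>Ideals and quotients\<close>

definition operad_ideal :: "('k::field, 'a) ns_operad \<Rightarrow> (nat \<Rightarrow> 'a set) \<Rightarrow> bool" where
  "operad_ideal P I \<longleftrightarrow>
    (\<forall>n. submodule (I n) ring_of_type_algebra (component P n)) \<and>
    (\<forall>m n i x y. 1 \<le> i \<longrightarrow> i \<le> m \<longrightarrow> x \<in> I m \<longrightarrow> y \<in> carrier (component P n) \<longrightarrow>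
      pcomp P m n i x y \<in> I (m + n - 1)) \<and>
    (\<forall>m n i x y. 1 \<le> i \<longrightarrow> i \<le> m \<longrightarrow> x \<in> carrier (component P m) \<longrightarrow> y \<in> I n \<longrightarrow>
      pcomp P m n i x y \<in> I (m + n - 1))"

definition operad_ideal_gen ::
  "('k::field, 'a) ns_operad \<Rightarrow> (nat \<Rightarrow> 'a set) \<Rightarrow> nat \<Rightarrow> 'a set" where
  "operad_ideal_gen P S n = \<Inter> {I n |I. operad_ideal P I \<and> (\<forall>m. S m \<subseteq> I m)}"

definition quotient_operad ::
  "('k::field, 'a) ns_operad \<Rightarrow> (nat \<Rightarrow> 'a set) \<Rightarrow> ('k, 'a set) ns_operad" where
  "quotient_operad P I = \<lparr>
    component = (\<lambda>n. \<lparr>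
      carrier = a_rcosets\<^bsub>component P n\<^esub> (I n),
      monoid.mult = undefined, one = undefined,
      ring.zero = I n, add = set_add (component P n),
      module.smult = (\<lambda>c A. \<Union>x\<in>A. I n +>\<^bsub>component P n\<^esub> (c \<odot>\<^bsub>component P n\<^esub> x))\<rparr>),
    pcomp = (\<lambda>m n i A B. \<Union>x\<in>A. \<Union>y\<in>B. I (m + n - 1) +>\<^bsub>component P (m + n - 1)\<^esub> pcomp P m n i x y),
    op_id = I 1 +>\<^bsub>component P 1\<^esub> op_id P\<rparr>"


section \<open>Vector spaces with a given basis\<close>

definition pm_scale :: "'k::field \<Rightarrow> ('b \<Rightarrow>\<^sub>0 'k) \<Rightarrow> ('b \<Rightarrow>\<^sub>0 'k)" where
  "pm_scale c x = Poly_Mapping.map ((*) c) x"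

definition lin_ext :: "('b \<Rightarrow> 'c \<Rightarrow>\<^sub>0 'k) \<Rightarrow> ('b \<Rightarrow>\<^sub>0 'k::field) \<Rightarrow> ('c \<Rightarrow>\<^sub>0 'k)" where
  "lin_ext f x = (\<Sum>b\<in>Poly_Mapping.keys x. pm_scale (Poly_Mapping.lookup x b) (f b))"

definition basis_vec :: "'b \<Rightarrow> ('b \<Rightarrow>\<^sub>0 'k::field)" where
  "basis_vec b = Poly_Mapping.single b 1"

definition tensor :: "('b \<Rightarrow>\<^sub>0 'k::field) \<Rightarrow> ('c \<Rightarrow>\<^sub>0 'k) \<Rightarrow> ('b \<times> 'c \<Rightarrow>\<^sub>0 'k)" where
  "tensor u v = lin_ext (\<lambda>b. lin_ext (\<lambda>c. basis_vec (b, c)) v) u"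


section \<open>The free ns operad on a graded set\<close>

text \<open>
  The free operad on the graded vector space with basis \<open>'g\<close>, the generator \<open>g\<close> having arity
  \<open>ar g\<close>, has as basis the planar rooted trees whose internal vertices are labelled by
  generators, each vertex having as many children as the arity of its label.  The arity of a tree
  is its number of leaves, which are numbered from the left starting with 1; partial composition is
  grafting.  The universal property is \<open>free_lift_hom\<close>, \<open>free_lift_gen\<close>, \<open>free_lift_unique\<close> below.
\<close>

datatype 'g ptree = Leaf | Node 'g "'g ptree list"

fun wf_tree :: "('g \<Rightarrow> nat) \<Rightarrow> 'g ptree \<Rightarrow> bool" where
  "wf_tree ar Leaf \<longleftrightarrow> True"
| "wf_tree ar (Node g ts) \<longleftrightarrow> length ts = ar g \<and> (\<forall>t\<in>set ts. wf_tree ar t)"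

primrec leaves :: "'g ptree \<Rightarrow> nat" where
  "leaves Leaf = 1"
| "leaves (Node g ts) = sum_list (map leaves ts)"

fun graft :: "'g ptree \<Rightarrow> nat \<Rightarrow> 'g ptree \<Rightarrow> 'g ptree"
  and graft_forest :: "'g ptree list \<Rightarrow> nat \<Rightarrow> 'g ptree \<Rightarrow> 'g ptree list" where
  "graft Leaf i t = (if i = 1 then t else Leaf)"
| "graft (Node g ts) i t = Node g (graft_forest ts i t)"
| "graft_forest [] i t = []"
| "graft_forest (s # ss) i t =
    (if i \<le> leaves s then graft s i t # ss else s # graft_forest ss (i - leaves s) t)"

definition free_operad :: "('g \<Rightarrow> nat) \<Rightarrow> ('k::field, 'g ptree \<Rightarrow>\<^sub>0 'k) ns_operad" where
  "free_operad ar = \<lparr>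
    component = (\<lambda>n. \<lparr>
      carrier = {x. \<forall>t\<in>Poly_Mapping.keys x. wf_tree ar t \<and> leaves t = n},
      monoid.mult = undefined, one = undefined,
      ring.zero = 0, add = (+), module.smult = pm_scale\<rparr>),
    pcomp = (\<lambda>m n i x y. lin_ext (\<lambda>s. lin_ext (\<lambda>t. basis_vec (graft s i t)) y) x),
    op_id = basis_vec Leaf\<rparr>"

definition free_gen :: "('g \<Rightarrow> nat) \<Rightarrow> 'g \<Rightarrow> ('g ptree \<Rightarrow>\<^sub>0 'k::field)" where
  "free_gen ar g = basis_vec (Node g (replicate (ar g) Leaf))"

text \<open>
  \<open>plug_all Q i x [(n\<^sub>i, y\<^sub>i), \<dots>, (n\<^sub>r, y\<^sub>r)]\<close>, for \<open>x\<close> of arity \<open>r\<close> and \<open>y\<^sub>j\<close> of arity \<open>n\<^sub>j\<close>, inserts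
  the \<open>y\<^sub>j\<close> into the inputs \<open>i, \<dots>, r\<close> of \<open>x\<close>, working from right to left so that
  the positions of the remaining inputs do not change.
\<close>

fun plug_all :: "('k, 'b) ns_operad \<Rightarrow> nat \<Rightarrow> 'b \<Rightarrow> (nat \<times> 'b) list \<Rightarrow> 'b" where
  "plug_all Q i x [] = x"
| "plug_all Q i x ((n, y) # ys) =
    pcomp Q (i + sum_list (map fst ys)) n i (plug_all Q (i + 1) x ys) y"

primrec eval_tree :: "('k, 'b) ns_operad \<Rightarrow> ('g \<Rightarrow> 'b) \<Rightarrow> 'g ptree \<Rightarrow> 'b" where
  "eval_tree Q \<phi> Leaf = op_id Q"
| "eval_tree Q \<phi> (Node g ts) = plug_all Q 1 (\<phi> g) (map (\<lambda>t. (leaves t, eval_tree Q \<phi> t)) ts)"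

definition free_lift ::
  "('k::field, 'b) ns_operad \<Rightarrow> ('g \<Rightarrow> 'b) \<Rightarrow> nat \<Rightarrow> ('g ptree \<Rightarrow>\<^sub>0 'k) \<Rightarrow> 'b" where
  "free_lift Q \<phi> n x =
    (\<Oplus>\<^bsub>component Q n\<^esub>t\<in>Poly_Mapping.keys x.
      Poly_Mapping.lookup x t \<odot>\<^bsub>component Q n\<^esub> eval_tree Q \<phi> t)"


section \<open>Binary quadratic operads\<close>

text \<open>
  \<open>V\<close> is the space with basis \<open>'g\<close>, so that \<open>quadratic\<close> is the direct sum of two copies of the
  tensor square of \<open>V\<close>, and \<open>relator\<close> identifies it with the component of arity 3 of the free operad
  on \<open>V\<close> (see \<open>relator_bij\<close>): the basis tensor \<open>p \<otimes> q\<close> stands for \<open>(x p y) q z\<close> in the first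
  summand and for \<open>- (x p (y q z))\<close> in the second.
\<close>

abbreviation free_binary :: "('k::field, 'g ptree \<Rightarrow>\<^sub>0 'k) ns_operad" where
  "free_binary \<equiv> free_operad (\<lambda>_. 2)"

type_synonym ('g, 'k) quadratic = "('g \<times> 'g \<Rightarrow>\<^sub>0 'k) \<times> ('g \<times> 'g \<Rightarrow>\<^sub>0 'k)"

definition relator :: "('g, 'k::field) quadratic \<Rightarrow> ('g ptree \<Rightarrow>\<^sub>0 'k)" where
  "relator w =
    lin_ext (\<lambda>(p, q). pcomp free_binary 2 2 1 (free_gen (\<lambda>_. 2) q) (free_gen (\<lambda>_. 2) p)) (fst w)
    - lin_ext (\<lambda>(p, q). pcomp free_binary 2 2 2 (free_gen (\<lambda>_. 2) p) (free_gen (\<lambda>_. 2) q)) (snd w)"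

definition binary_operad ::
  "('g, 'k::field) quadratic set \<Rightarrow> ('k, ('g ptree \<Rightarrow>\<^sub>0 'k) set) ns_operad" where
  "binary_operad \<Lambda> = quotient_operad free_binary
    (operad_ideal_gen free_binary (\<lambda>n. if n = 3 then relator ` \<Lambda> else {}))"


section \<open>Extended dendriform algebras\<close>

datatype dend = Prec | Succ

abbreviation prec :: "dend \<Rightarrow>\<^sub>0 'k::field" where "prec \<equiv> basis_vec Prec"
abbreviation succ :: "dend \<Rightarrow>\<^sub>0 'k::field" where "succ \<equiv> basis_vec Succ"
abbreviation star :: "dend \<Rightarrow>\<^sub>0 'k::field" where "star \<equiv> prec + succ"

definition quad_scale :: "'k::field \<Rightarrow> ('g, 'k) quadratic \<Rightarrow> ('g, 'k) quadratic" where
  "quad_scale c w = (pm_scale c (fst w), pm_scale c (snd w))"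

definition ED_relations :: "'k::field \<Rightarrow> 'k \<Rightarrow> (dend, 'k) quadratic set" where
  "ED_relations lam kap =
    {quad_scale a (tensor prec prec, tensor prec star)
     + quad_scale b (tensor succ prec, tensor succ prec)
     + quad_scale c (tensor star succ, tensor succ succ) |a b c.
      lam * a = 0 \<and> lam * c = 0 \<and> kap * (a - c) = 0}"

definition ED :: "'k::field \<Rightarrow> 'k \<Rightarrow> ('k, (dend ptree \<Rightarrow>\<^sub>0 'k) set) ns_operad" where
  "ED lam kap = binary_operad (ED_relations lam kap)"


section \<open>Extended Rota-Baxter algebras\<close>

datatype rb = Rho | Mu

primrec rb_arity :: "rb \<Rightarrow> nat" where
  "rb_arity Rho = 1"
| "rb_arity Mu = 2"

abbreviation free_rb :: "('k::field, rb ptree \<Rightarrow>\<^sub>0 'k) ns_operad" where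
  "free_rb \<equiv> free_operad rb_arity"

abbreviation rho :: "rb ptree \<Rightarrow>\<^sub>0 'k::field" where "rho \<equiv> free_gen rb_arity Rho"
abbreviation mu :: "rb ptree \<Rightarrow>\<^sub>0 'k::field" where "mu \<equiv> free_gen rb_arity Mu"

definition assoc_relator :: "rb ptree \<Rightarrow>\<^sub>0 'k::field" where
  "assoc_relator = pcomp free_rb 2 2 1 mu mu - pcomp free_rb 2 2 2 mu mu"

definition ERB_relator :: "'k::field \<Rightarrow> 'k \<Rightarrow> (rb ptree \<Rightarrow>\<^sub>0 'k)" where
  "ERB_relator lam kap =
    pcomp free_rb 2 1 1 (pcomp free_rb 2 1 2 mu rho) rho
    - pcomp free_rb 1 2 1 rho (pcomp free_rb 2 1 2 mu rho)
    - pcomp free_rb 1 2 1 rho (pcomp free_rb 2 1 1 mu rho)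
    - pm_scale lam (pcomp free_rb 1 2 1 rho mu)
    - pm_scale kap mu"

definition ERB_ideal :: "'k::field \<Rightarrow> 'k \<Rightarrow> nat \<Rightarrow> (rb ptree \<Rightarrow>\<^sub>0 'k) set" where
  "ERB_ideal lam kap = operad_ideal_gen free_rb
    (\<lambda>n. if n = 2 then {ERB_relator lam kap} else if n = 3 then {assoc_relator} else {})"

definition ERB :: "'k::field \<Rightarrow> 'k \<Rightarrow> ('k, (rb ptree \<Rightarrow>\<^sub>0 'k) set) ns_operad" where
  "ERB lam kap = quotient_operad free_rb (ERB_ideal lam kap)"

definition ERB_rho :: "'k::field \<Rightarrow> 'k \<Rightarrow> (rb ptree \<Rightarrow>\<^sub>0 'k) set" where
  "ERB_rho lam kap = ERB_ideal lam kap 1 +>\<^bsub>component free_rb 1\<^esub> rho"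

definition ERB_mu :: "'k::field \<Rightarrow> 'k \<Rightarrow> (rb ptree \<Rightarrow>\<^sub>0 'k) set" where
  "ERB_mu lam kap = ERB_ideal lam kap 2 +>\<^bsub>component free_rb 2\<^esub> mu"


section \<open>The di-companion\<close>

text \<open>
  \<open>Q\<close> is an operad presented by generators \<open>r\<close> in arity 1 and \<open>m\<close> in arity 2.  \<open>dc_hom_unique\<close> below
  shows that \<open>dc_hom Q r m\<close> is the only homomorphism satisfying \<open>is_dc_hom Q r m\<close>.
\<close>

definition dc_hom ::
  "('k::field, 'b) ns_operad \<Rightarrow> 'b \<Rightarrow> 'b \<Rightarrow> nat \<Rightarrow> (dend ptree \<Rightarrow>\<^sub>0 'k) \<Rightarrow> 'b" where
  "dc_hom Q r m = free_lift Q (\<lambda>g. case g of Prec \<Rightarrow> pcomp Q 2 1 2 m r | Succ \<Rightarrow> pcomp Q 2 1 1 m r)"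

definition is_dc_hom ::
  "('k::field, 'b) ns_operad \<Rightarrow> 'b \<Rightarrow> 'b \<Rightarrow> (nat \<Rightarrow> (dend ptree \<Rightarrow>\<^sub>0 'k) \<Rightarrow> 'b) \<Rightarrow> bool" where
  "is_dc_hom Q r m \<Psi> \<longleftrightarrow> operad_hom free_binary Q \<Psi> \<and>
    \<Psi> 2 (free_gen (\<lambda>_. 2) Prec) = pcomp Q 2 1 2 m r \<and>
    \<Psi> 2 (free_gen (\<lambda>_. 2) Succ) = pcomp Q 2 1 1 m r"

text \<open>
  The intersection of the kernel with the component of arity 3, as a set of \<open>quadratic\<close> elements.
\<close>

definition quadratic_kernel ::
  "('k::field, 'b) ns_operad \<Rightarrow> (nat \<Rightarrow> ('g ptree \<Rightarrow>\<^sub>0 'k) \<Rightarrow> 'b) \<Rightarrow> ('g, 'k) quadratic set" where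
  "quadratic_kernel Q f = relator -` a_kernel (component free_binary 3) (component Q 3) (f 3)"

definition DC ::
  "('k::field, 'b) ns_operad \<Rightarrow> 'b \<Rightarrow> 'b \<Rightarrow> ('k, (dend ptree \<Rightarrow>\<^sub>0 'k) set) ns_operad" where
  "DC Q r m = binary_operad (quadratic_kernel Q (dc_hom Q r m))"


section \<open>The free operad is an ns operad\<close>

lemma lookup_pm_scale [simp]: "Poly_Mapping.lookup (pm_scale c x) b = c * Poly_Mapping.lookup x b"
  by (simp add: pm_scale_def Poly_Mapping.map.rep_eq when_def)

lemma pm_scale_simps [simp]:
  "pm_scale c 0 = 0" "pm_scale 0 x = 0" "pm_scale 1 x = x"
  "pm_scale a (pm_scale b x) = pm_scale (a * b) x"
  by (auto intro!: poly_mapping_eqI)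

lemma pm_scale_add: "pm_scale c (x + y) = pm_scale c x + pm_scale c y"
  and pm_scale_add_left: "pm_scale (a + b) x = pm_scale a x + pm_scale b x"
  and pm_scale_diff: "pm_scale c (x - y) = pm_scale c x - pm_scale c y"
  and pm_scale_minus: "pm_scale (-1) x = - x"
  by (auto intro!: poly_mapping_eqI simp: lookup_add lookup_minus algebra_simps)

lemma pm_scale_sum: "pm_scale c (sum f A) = (\<Sum>a\<in>A. pm_scale c (f a))"
  by (induction A rule: infinite_finite_induct) (auto simp: pm_scale_add)

lemma keys_pm_scale: "Poly_Mapping.keys (pm_scale c x) \<subseteq> Poly_Mapping.keys x"
  by (auto simp: in_keys_iff)

lemma keys_basis_vec [simp]: "Poly_Mapping.keys (basis_vec b) = {b}"
  by (simp add: basis_vec_def)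

lemma lin_ext_superset:
  assumes "finite S" "Poly_Mapping.keys x \<subseteq> S"
  shows "lin_ext f x = (\<Sum>b\<in>S. pm_scale (Poly_Mapping.lookup x b) (f b))"
  unfolding lin_ext_def using assms
  by (intro sum.mono_neutral_left) (auto simp: in_keys_iff)

lemma lin_ext_add: "lin_ext f (x + y) = lin_ext f x + lin_ext f y"
proof -
  let ?S = "Poly_Mapping.keys x \<union> Poly_Mapping.keys y"
  have "lin_ext f z = (\<Sum>b\<in>?S. pm_scale (Poly_Mapping.lookup z b) (f b))" if "z \<in> {x, y, x + y}" for z
    using that Poly_Mapping.keys_add[of x y] by (intro lin_ext_superset) auto
  then show ?thesis by (simp add: lookup_add pm_scale_add_left sum.distrib)
qed

lemma lin_ext_scale: "lin_ext f (pm_scale c x) = pm_scale c (lin_ext f x)"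
  by (subst lin_ext_superset[of "Poly_Mapping.keys x"])
    (auto simp: keys_pm_scale pm_scale_sum lin_ext_def)

lemma lin_ext_zero [simp]: "lin_ext f 0 = 0"
  by (simp add: lin_ext_def)

lemma lin_ext_sum: "lin_ext f (sum g A) = (\<Sum>a\<in>A. lin_ext f (g a))"
  by (induction A rule: infinite_finite_induct) (auto simp: lin_ext_add)

lemma lin_ext_basis [simp]: "lin_ext f (basis_vec b) = f b"
  by (simp add: lin_ext_def) (simp add: basis_vec_def)

lemma lin_ext_basis_vec: "lin_ext basis_vec x = x"
proof (rule poly_mapping_eqI)
  fix k
  have "Poly_Mapping.lookup (lin_ext basis_vec x) k =
     (\<Sum>b\<in>Poly_Mapping.keys x. if b = k then Poly_Mapping.lookup x k else 0)"
    unfolding lin_ext_def lookup_sum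
    by (intro sum.cong) (auto simp: basis_vec_def lookup_single)
  then show "Poly_Mapping.lookup (lin_ext basis_vec x) k = Poly_Mapping.lookup x k"
    by (simp add: sum.delta' in_keys_iff)
qed

lemma lin_ext_cong:
  "(\<And>b. b \<in> Poly_Mapping.keys x \<Longrightarrow> f b = g b) \<Longrightarrow> lin_ext f x = lin_ext g x"
  by (simp add: lin_ext_def)

lemma lin_ext_lin_ext: "lin_ext g (lin_ext f x) = lin_ext (\<lambda>b. lin_ext g (f b)) x"
  by (simp add: lin_ext_def[of f] lin_ext_def[of "\<lambda>b. lin_ext g (f b)"] lin_ext_sum lin_ext_scale)

lemma lin_ext_add_fun: "lin_ext (\<lambda>b. f b + g b) x = lin_ext f x + lin_ext g x"
  by (simp add: lin_ext_def pm_scale_add sum.distrib)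

lemma lin_ext_scale_fun: "lin_ext (\<lambda>b. pm_scale c (f b)) x = pm_scale c (lin_ext f x)"
  by (simp add: lin_ext_def pm_scale_sum mult.commute)

lemma lin_ext_swap:
  "lin_ext (\<lambda>a. lin_ext (\<lambda>b. f a b) y) x = lin_ext (\<lambda>b. lin_ext (\<lambda>a. f a b) x) y"
  unfolding lin_ext_def
  by (simp add: pm_scale_sum mult.commute) (rule sum.swap)

lemma keys_lin_ext:
  "Poly_Mapping.keys (lin_ext f x) \<subseteq> (\<Union>b\<in>Poly_Mapping.keys x. Poly_Mapping.keys (f b))"
proof
  fix k assume "k \<in> Poly_Mapping.keys (lin_ext f x)"
  then have "(\<Sum>b\<in>Poly_Mapping.keys x. Poly_Mapping.lookup x b * Poly_Mapping.lookup (f b) k) \<noteq> 0"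
    by (simp add: in_keys_iff lin_ext_def lookup_sum)
  then obtain b where "b \<in> Poly_Mapping.keys x" "Poly_Mapping.lookup (f b) k \<noteq> 0"
    by (metis (no_types, lifting) mult_zero_right sum.neutral)
  then show "k \<in> (\<Union>b\<in>Poly_Mapping.keys x. Poly_Mapping.keys (f b))"
    by (auto simp: in_keys_iff)
qed

lemma lin_comb_induct [consumes 1, case_names zero add]:
  assumes "Poly_Mapping.keys x \<subseteq> B"
    and "R 0"
    and "\<And>c b y. \<lbrakk>b \<in> B; Poly_Mapping.keys y \<subseteq> B; R y\<rbrakk> \<Longrightarrow> R (pm_scale c (basis_vec b) + y)"
  shows "R x"
proof -
  have "R (\<Sum>b\<in>S. pm_scale (Poly_Mapping.lookup x b) (basis_vec b)) \<and>
      Poly_Mapping.keys (\<Sum>b\<in>S. pm_scale (Poly_Mapping.lookup x b) (basis_vec b)) \<subseteq> B"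
    if "finite S" "S \<subseteq> B" for S
    using that
  proof (induction S rule: finite_induct)
    case (insert b S)
    let ?z = "pm_scale (Poly_Mapping.lookup x b) (basis_vec b)"
    let ?y = "(\<Sum>b\<in>S. pm_scale (Poly_Mapping.lookup x b) (basis_vec b))"
    have "Poly_Mapping.keys ?z \<subseteq> B"
      using keys_pm_scale[of "Poly_Mapping.lookup x b" "basis_vec b"] insert.prems by auto
    then show ?case
      using insert assms(3)[of b ?y] Poly_Mapping.keys_add[of ?z ?y] by auto
  qed (simp add: assms(2))
  from this[OF finite_keys assms(1)] lin_ext_basis_vec[of x] show ?thesis
    by (simp add: lin_ext_def)
qed

lemma leaves_graft:
  "1 \<le> i \<Longrightarrow> i \<le> leaves s \<Longrightarrow> leaves (graft s i t) = leaves s + leaves t - 1"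
  "1 \<le> i \<Longrightarrow> i \<le> sum_list (map leaves ss) \<Longrightarrow>
    sum_list (map leaves (graft_forest ss i t)) = sum_list (map leaves ss) + leaves t - 1"
  by (induction s i t and ss i t rule: graft_graft_forest.induct) auto

lemma length_graft_forest [simp]: "length (graft_forest ss i t) = length ss"
  by (induction ss arbitrary: i) auto

lemma wf_graft:
  "wf_tree ar s \<Longrightarrow> wf_tree ar t \<Longrightarrow> wf_tree ar (graft s i t)"
  "\<forall>s\<in>set ss. wf_tree ar s \<Longrightarrow> wf_tree ar t \<Longrightarrow> \<forall>s\<in>set (graft_forest ss i t). wf_tree ar s"
  by (induction s i t and ss i t rule: graft_graft_forest.induct) auto

lemma graft_Leaf_right:
  "t = Leaf \<Longrightarrow> graft s i t = s"
  "t = Leaf \<Longrightarrow> graft_forest ss i t = ss"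
  by (induction s i t and ss i t rule: graft_graft_forest.induct) auto

lemma graft_sequential:
  "1 \<le> i \<Longrightarrow> i \<le> leaves s \<Longrightarrow> 1 \<le> j \<Longrightarrow> j \<le> leaves t \<Longrightarrow>
    graft (graft s i t) (i + j - 1) u = graft s i (graft t j u)"
  "1 \<le> i \<Longrightarrow> i \<le> sum_list (map leaves ss) \<Longrightarrow> 1 \<le> j \<Longrightarrow> j \<le> leaves t \<Longrightarrow>
    graft_forest (graft_forest ss i t) (i + j - 1) u = graft_forest ss i (graft t j u)"
proof (induction s i t and ss i t rule: graft_graft_forest.induct)
  case (4 s ss i t)
  then show ?case by (auto simp: leaves_graft)
qed auto

lemma graft_parallel:
  "1 \<le> i \<Longrightarrow> i < k \<Longrightarrow> k \<le> leaves s \<Longrightarrow>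
    graft (graft s i t) (k + leaves t - 1) u = graft (graft s k u) i t"
  "1 \<le> i \<Longrightarrow> i < k \<Longrightarrow> k \<le> sum_list (map leaves ss) \<Longrightarrow>
    graft_forest (graft_forest ss i t) (k + leaves t - 1) u = graft_forest (graft_forest ss k u) i t"
proof (induction s i t and ss i t arbitrary: k and k rule: graft_graft_forest.induct)
  case (4 s ss i t)
  consider "k \<le> leaves s" | "i \<le> leaves s" "leaves s < k" | "leaves s < i" by linarith
  then show ?case
  proof cases
    case 1 then show ?thesis using 4 by (auto simp: leaves_graft)
  next
    case 2
    have "k + leaves t - 1 - (leaves s + leaves t - 1) = k - leaves s" using 2 4 by linarith
    moreover have "\<not> k + leaves t - 1 \<le> leaves s + leaves t - 1" using 2 4 by linarith
    ultimately show ?thesis using 2 4 by (auto simp: leaves_graft)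
  next
    case 3
    have "k + leaves t - 1 - leaves s = (k - leaves s) + leaves t - 1" using 3 4 by linarith
    moreover have "\<not> k + leaves t - 1 \<le> leaves s" using 3 4 by linarith
    moreover have "graft_forest (graft_forest ss (i - leaves s) t) (k - leaves s + leaves t - 1) u =
        graft_forest (graft_forest ss (k - leaves s) u) (i - leaves s) t"
      using 3 4(3-) by (intro 4(2)) auto
    ultimately show ?thesis using 3 4(3-) by auto
  qed
qed auto

lemma free_operad_simps:
  "carrier (component (free_operad ar) n) = {x. Poly_Mapping.keys x \<subseteq> {t. wf_tree ar t \<and> leaves t = n}}"
  "x \<oplus>\<^bsub>component (free_operad ar) n\<^esub> y = x + y"
  "\<zero>\<^bsub>component (free_operad ar) n\<^esub> = 0"
  "c \<odot>\<^bsub>component (free_operad ar) n\<^esub> x = pm_scale c x"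
  "pcomp (free_operad ar) m n i x y = lin_ext (\<lambda>s. lin_ext (\<lambda>t. basis_vec (graft s i t)) y) x"
  "op_id (free_operad ar) = basis_vec Leaf"
  by (auto simp: free_operad_def)

lemma free_operad_module:
  "module (ring_of_type_algebra :: 'k::field ring) (component (free_operad (ar :: 'g \<Rightarrow> nat)) n)"
proof (rule moduleI)
  let ?M = "component (free_operad ar) n :: ('k, 'g ptree \<Rightarrow>\<^sub>0 'k) module"
  show "cring (ring_of_type_algebra :: 'k ring)" by (rule cring_from_type_algebra)
  show "abelian_group ?M"
  proof (rule abelian_groupI)
    show "\<exists>y\<in>carrier ?M. y \<oplus>\<^bsub>?M\<^esub> x = \<zero>\<^bsub>?M\<^esub>" if "x \<in> carrier ?M" for x
      using that by (intro bexI[of _ "-x"]) (auto simp: free_operad_simps)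
    show "x \<oplus>\<^bsub>?M\<^esub> y \<in> carrier ?M" if "x \<in> carrier ?M" "y \<in> carrier ?M" for x y
      using that Poly_Mapping.keys_add[of x y] by (auto simp: free_operad_simps)
  qed (simp_all add: free_operad_simps algebra_simps)
  show "c \<odot>\<^bsub>?M\<^esub> x \<in> carrier ?M" if "x \<in> carrier ?M" for c x
    using that keys_pm_scale[of c x] by (auto simp: free_operad_simps)
qed (simp_all add: free_operad_simps ring_of_type_algebra_def pm_scale_add pm_scale_add_left)

theorem free_operad_ns_operad: "ns_operad (free_operad ar)"
proof (rule ns_operad.intro, goal_cases)
  case 1 show ?case
    by (rule free_operad_module)
next
  case 2 then show ?case by (simp add: free_operad_simps)
next
  case (3 i m x y n)
  have "wf_tree ar v \<and> leaves v = m + n - 1"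
    if "v \<in> Poly_Mapping.keys (lin_ext (\<lambda>s. lin_ext (\<lambda>t. basis_vec (graft s i t)) y) x)" for v
  proof -
    obtain s where s: "s \<in> Poly_Mapping.keys x"
      "v \<in> Poly_Mapping.keys (lin_ext (\<lambda>t. basis_vec (graft s i t)) y)"
      using keys_lin_ext[of "\<lambda>s. lin_ext (\<lambda>t. basis_vec (graft s i t)) y" x] \<open>v \<in> _\<close> by auto
    then obtain t where t: "t \<in> Poly_Mapping.keys y" "v = graft s i t"
      using keys_lin_ext[of "\<lambda>t. basis_vec (graft s i t)" y] by auto
    have "wf_tree ar s" "leaves s = m" "wf_tree ar t" "leaves t = n"
      using s(1) t(1) 3 by (auto simp: free_operad_simps)
    then show ?thesis using t(2) 3(1,2) by (simp add: leaves_graft(1) wf_graft(1))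
  qed
  then show ?case unfolding free_operad_simps by auto
next
  case (8 x n) then show ?case by (simp add: free_operad_simps lin_ext_basis_vec)
next
  case (9 i n x) then show ?case by (simp add: free_operad_simps lin_ext_basis_vec graft_Leaf_right)
next
  case (10 i l j m x y z n)
  show ?case unfolding free_operad_simps lin_ext_lin_ext lin_ext_basis
    using 10 by (intro lin_ext_cong) (auto simp: free_operad_simps subset_iff graft_sequential[unfolded One_nat_def])
next
  case (11 i k l x y m z n)
  have "pcomp (free_operad ar) (l + m - 1) n (k + m - 1) (pcomp (free_operad ar) l m i x y) z =
    lin_ext (\<lambda>s. lin_ext (\<lambda>t. lin_ext (\<lambda>u. basis_vec (graft (graft s k u) i t)) z) y) x"
    unfolding free_operad_simps lin_ext_lin_ext lin_ext_basis
    using 11 by (intro lin_ext_cong) (auto simp: free_operad_simps subset_iff graft_parallel[unfolded One_nat_def])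
  then show ?case
    unfolding free_operad_simps lin_ext_lin_ext lin_ext_basis by (subst (2) lin_ext_swap) simp
qed (simp_all add: free_operad_simps lin_ext_add lin_ext_scale lin_ext_add_fun lin_ext_scale_fun)

section \<open>Quotients of ns operads are ns operads\<close>

lemma operad_ideal_gen_subset: "S n \<subseteq> operad_ideal_gen P S n"
  by (auto simp: operad_ideal_gen_def)

lemma operad_ideal_gen_least:
  "operad_ideal P I \<Longrightarrow> (\<And>m. S m \<subseteq> I m) \<Longrightarrow> operad_ideal_gen P S n \<subseteq> I n"
  by (auto simp: operad_ideal_gen_def)

context ns_operad
begin

lemmas pcomp_closed' = pcomp_closed[unfolded One_nat_def]

lemma operad_ideal_carrier: "operad_ideal P (\<lambda>n. carrier (component P n))"
  unfolding operad_ideal_def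
  by (intro conjI allI impI module.carrier_is_submodule[OF component_module] pcomp_closed)

theorem operad_ideal_gen_ideal:
  assumes S: "\<And>n. S n \<subseteq> carrier (component P n)"
  shows "operad_ideal P (operad_ideal_gen P S)"
proof -
  let ?F = "{I. operad_ideal P I \<and> (\<forall>m. S m \<subseteq> I m)}"
  have mem: "x \<in> operad_ideal_gen P S n \<longleftrightarrow> (\<forall>I\<in>?F. x \<in> I n)" for x n
    by (auto simp: operad_ideal_gen_def)
  have F: "(\<lambda>n. carrier (component P n)) \<in> ?F"
    using operad_ideal_carrier S by auto
  have sub: "submodule (I n) ring_of_type_algebra (component P n)" if "I \<in> ?F" for I n
    using that by (auto simp: operad_ideal_def)
  have "submodule (operad_ideal_gen P S n) ring_of_type_algebra (component P n)" for n
  proof (rule module.submoduleI[OF component_module])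
    interpret module ring_of_type_algebra "component P n" by (rule component_module)
    show "operad_ideal_gen P S n \<subseteq> carrier (component P n)" using F by (auto simp: mem)
    show "\<zero>\<^bsub>component P n\<^esub> \<in> operad_ideal_gen P S n"
      using subgroup.one_closed[OF submodule.axioms(1)[OF sub]] by (auto simp: mem)
    show "\<ominus>\<^bsub>component P n\<^esub> a \<in> operad_ideal_gen P S n" if "a \<in> operad_ideal_gen P S n" for a
      using that submoduleE(3)[OF sub] by (auto simp: mem)
    show "a \<oplus>\<^bsub>component P n\<^esub> b \<in> operad_ideal_gen P S n"
      if "a \<in> operad_ideal_gen P S n" "b \<in> operad_ideal_gen P S n" for a b
      using that submoduleE(5)[OF sub] by (auto simp: mem)
    show "a \<odot>\<^bsub>component P n\<^esub> x \<in> operad_ideal_gen P S n"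
      if "a \<in> carrier ring_of_type_algebra" "x \<in> operad_ideal_gen P S n" for a x
      using that submoduleE(4)[OF sub] by (auto simp: mem)
  qed
  moreover have "pcomp P m n i x y \<in> operad_ideal_gen P S (m + n - 1)"
    if "1 \<le> i" "i \<le> m" "x \<in> operad_ideal_gen P S m" "y \<in> carrier (component P n)" for m n i x y
    unfolding mem
  proof
    fix I assume "I \<in> ?F"
    then have "operad_ideal P I" "x \<in> I m" using that(3) unfolding mem by auto
    then show "pcomp P m n i x y \<in> I (m + n - 1)"
      using that unfolding operad_ideal_def by blast
  qed
  moreover have "pcomp P m n i x y \<in> operad_ideal_gen P S (m + n - 1)"
    if "1 \<le> i" "i \<le> m" "x \<in> carrier (component P m)" "y \<in> operad_ideal_gen P S n" for m n i x y
    unfolding mem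
  proof
    fix I assume "I \<in> ?F"
    then have "operad_ideal P I" "y \<in> I n" using that(4) unfolding mem by auto
    then show "pcomp P m n i x y \<in> I (m + n - 1)"
      using that unfolding operad_ideal_def by blast
  qed
  ultimately show ?thesis unfolding operad_ideal_def by blast
qed

end

locale ns_operad_ideal = ns_operad P for P :: "('k::field, 'a) ns_operad" +
  fixes I :: "nat \<Rightarrow> 'a set"
  assumes ideal: "operad_ideal P I"
begin

abbreviation (input) cls :: "nat \<Rightarrow> 'a \<Rightarrow> 'a set" where
  "cls n x \<equiv> I n +>\<^bsub>component P n\<^esub> x"

abbreviation (input) QP :: "('k, 'a set) ns_operad" where
  "QP \<equiv> quotient_operad P I"

lemma sub: "submodule (I n) ring_of_type_algebra (component P n)"
  using ideal by (auto simp: operad_ideal_def)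

lemma ideal_left:
  "\<lbrakk>1 \<le> i; i \<le> m; x \<in> I m; y \<in> carrier (component P n)\<rbrakk> \<Longrightarrow> pcomp P m n i x y \<in> I (m + n - 1)"
  using ideal unfolding operad_ideal_def by blast

lemma ideal_right:
  "\<lbrakk>1 \<le> i; i \<le> m; x \<in> carrier (component P m); y \<in> I n\<rbrakk> \<Longrightarrow> pcomp P m n i x y \<in> I (m + n - 1)"
  using ideal unfolding operad_ideal_def by blast

lemma asub: "abelian_subgroup (I n) (component P n)"
  using component_module[of n] submodule.axioms(1)[OF sub[of n]]
  by (intro abelian_subgroupI3) (auto simp: module_def additive_subgroup_def)

lemma UNIV_K [simp]: "c \<in> carrier ring_of_type_algebra"
  by (simp add: ring_of_type_algebra_def)

lemma carrier_cls:
  "A \<in> carrier (component QP n) \<longleftrightarrow> (\<exists>x\<in>carrier (component P n). A = cls n x)"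
  by (simp add: quotient_operad_def A_RCOSETS_def RCOSETS_def a_r_coset_def)

lemma cls_in_carrier:
  "x \<in> carrier (component P n) \<Longrightarrow> cls n x \<in> carrier (component QP n)"
  by (auto simp: carrier_cls)

lemma mem_cls: 
  assumes "x \<in> carrier (component P n)"
  shows "y \<in> cls n x \<longleftrightarrow> y \<in> carrier (component P n) \<and> (\<exists>h\<in>I n. y = h \<oplus>\<^bsub>component P n\<^esub> x)"
proof -
  interpret module ring_of_type_algebra "component P n" by (rule component_module)
  interpret s: abelian_subgroup "I n" "component P n" by (rule asub)
  show ?thesis using assms s.a_subset by (auto simp: a_r_coset_def')
qed

lemma self_cls: "x \<in> carrier (component P n) \<Longrightarrow> x \<in> cls n x"
  by (rule abelian_subgroup.a_rcos_self[OF asub])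

lemma cls_eqI:
  assumes "x \<in> carrier (component P n)" "h \<in> I n" "y = h \<oplus>\<^bsub>component P n\<^esub> x"
  shows "cls n y = cls n x"
proof -
  interpret s: abelian_subgroup "I n" "component P n" by (rule asub)
  have "y \<in> cls n x" using assms by (auto simp: a_r_coset_def')
  then show ?thesis using s.a_repr_independence[OF _ assms(1) s.a_subgroup] by simp
qed

lemma cls_add:
  assumes "x \<in> carrier (component P n)" "y \<in> carrier (component P n)"
  shows "cls n x \<oplus>\<^bsub>component QP n\<^esub> cls n y = cls n (x \<oplus>\<^bsub>component P n\<^esub> y)"
  using abelian_subgroup.a_rcos_sum[OF asub assms] by (simp add: quotient_operad_def)

lemma cls_zero: "\<zero>\<^bsub>component QP n\<^esub> = cls n \<zero>\<^bsub>component P n\<^esub>"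
proof -
  interpret module ring_of_type_algebra "component P n" by (rule component_module)
  interpret s: abelian_subgroup "I n" "component P n" by (rule asub)
  have "cls n \<zero>\<^bsub>component P n\<^esub> = (\<Union>h\<in>I n. {h \<oplus>\<^bsub>component P n\<^esub> \<zero>\<^bsub>component P n\<^esub>})"
    by (simp add: a_r_coset_def')
  also have "\<dots> = (\<Union>h\<in>I n. {h})"
    by (intro SUP_cong refl) (simp add: s.a_Hcarr)
  finally show ?thesis by (simp add: quotient_operad_def)
qed

lemma cls_id: "op_id QP = cls 1 (op_id P)"
  by (simp add: quotient_operad_def)

lemma cls_smult:
  assumes x: "x \<in> carrier (component P n)"
  shows "c \<odot>\<^bsub>component QP n\<^esub> cls n x = cls n (c \<odot>\<^bsub>component P n\<^esub> x)"
proof -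
  interpret module ring_of_type_algebra "component P n" by (rule component_module)
  interpret s: abelian_subgroup "I n" "component P n" by (rule asub)
  have "cls n (c \<odot>\<^bsub>component P n\<^esub> y) = cls n (c \<odot>\<^bsub>component P n\<^esub> x)" if "y \<in> cls n x" for y
  proof -
    obtain h where h: "h \<in> I n" "y = h \<oplus>\<^bsub>component P n\<^esub> x" using \<open>y \<in> cls n x\<close> mem_cls[OF x] by auto
    then have "c \<odot>\<^bsub>component P n\<^esub> y = c \<odot>\<^bsub>component P n\<^esub> h \<oplus>\<^bsub>component P n\<^esub> c \<odot>\<^bsub>component P n\<^esub> x"
      using x s.a_subset by (simp add: smult_r_distr subset_iff)
    then show ?thesis
      using h x submoduleE(4)[OF sub] by (intro cls_eqI) auto
  qed
  then have "(\<Union>y\<in>cls n x. cls n (c \<odot>\<^bsub>component P n\<^esub> y)) = (\<Union>y\<in>cls n x. cls n (c \<odot>\<^bsub>component P n\<^esub> x))"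
    by (intro SUP_cong refl) simp
  also have "\<dots> = cls n (c \<odot>\<^bsub>component P n\<^esub> x)"
    using self_cls[OF x] by (simp only: UN_constant) auto
  finally show ?thesis by (simp add: quotient_operad_def)
qed

lemma cls_pcomp:
  assumes x: "x \<in> carrier (component P m)" and y: "y \<in> carrier (component P n)"
    and i: "1 \<le> i" "i \<le> m"
  shows "pcomp QP m n i (cls m x) (cls n y) = cls (m + n - 1) (pcomp P m n i x y)"
proof -
  interpret M: module ring_of_type_algebra "component P m" by (rule component_module)
  interpret N: module ring_of_type_algebra "component P n" by (rule component_module)
  interpret L: module ring_of_type_algebra "component P (m + n - 1)" by (rule component_module)
  have "cls (m + n - 1) (pcomp P m n i x' y') = cls (m + n - 1) (pcomp P m n i x y)"
    if "x' \<in> cls m x" "y' \<in> cls n y" for x' y'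
  proof -
    obtain h where h: "h \<in> I m" "x' = h \<oplus>\<^bsub>component P m\<^esub> x" using \<open>x' \<in> cls m x\<close> mem_cls[OF x] by auto
    obtain k where k: "k \<in> I n" "y' = k \<oplus>\<^bsub>component P n\<^esub> y" using \<open>y' \<in> cls n y\<close> mem_cls[OF y] by auto
    have hk: "h \<in> carrier (component P m)" "k \<in> carrier (component P n)"
      using h k M.submoduleE(1)[OF sub] N.submoduleE(1)[OF sub] by auto
    have x': "x' \<in> carrier (component P m)" and y': "y' \<in> carrier (component P n)"
      using h k hk x y by auto
    have "pcomp P m n i x' y' = pcomp P m n i x' k \<oplus>\<^bsub>component P (m + n - 1)\<^esub> pcomp P m n i x' y"
      using hk x' y i unfolding k(2) by (intro pcomp_add_right) auto
    then have "cls (m + n - 1) (pcomp P m n i x' y') = cls (m + n - 1) (pcomp P m n i x' y)"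
      by (rule cls_eqI[OF pcomp_closed[OF i x' y] ideal_right[OF i x' k(1)]])
    also have "pcomp P m n i x' y = pcomp P m n i h y \<oplus>\<^bsub>component P (m + n - 1)\<^esub> pcomp P m n i x y"
      using hk x y i unfolding h(2) by (intro pcomp_add_left) auto
    then have "cls (m + n - 1) (pcomp P m n i x' y) = cls (m + n - 1) (pcomp P m n i x y)"
      by (rule cls_eqI[OF pcomp_closed[OF i x y] ideal_left[OF i h(1) y]])
    finally show ?thesis .
  qed
  then have "(\<Union>x'\<in>cls m x. \<Union>y'\<in>cls n y. cls (m + n - 1) (pcomp P m n i x' y')) =
      (\<Union>x'\<in>cls m x. \<Union>y'\<in>cls n y. cls (m + n - 1) (pcomp P m n i x y))"
    by (intro SUP_cong refl) simp
  also have "\<dots> = cls (m + n - 1) (pcomp P m n i x y)"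
    using self_cls[OF x] self_cls[OF y] by (simp only: UN_constant) auto
  finally show ?thesis by (simp add: quotient_operad_def)
qed

lemma quotient_module: "module ring_of_type_algebra (component QP n)"
proof -
  interpret module ring_of_type_algebra "component P n" by (rule component_module)
  interpret s: abelian_subgroup "I n" "component P n" by (rule asub)
  show ?thesis
  proof (rule moduleI)
    show "cring (ring_of_type_algebra :: 'k ring)" by (rule cring_from_type_algebra)
    show "abelian_group (component QP n)"
    proof (rule abelian_groupI)
      show "\<exists>B\<in>carrier (component QP n). B \<oplus>\<^bsub>component QP n\<^esub> A = \<zero>\<^bsub>component QP n\<^esub>"
        if A: "A \<in> carrier (component QP n)" for A
      proof -
        obtain x where x: "x \<in> carrier (component P n)" "A = cls n x"
          using A by (auto simp: carrier_cls)
        then show ?thesis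
          by (intro bexI[of _ "cls n (\<ominus>\<^bsub>component P n\<^esub> x)"])
            (auto simp: cls_add cls_zero l_neg cls_in_carrier)
      qed
    qed (auto simp: carrier_cls cls_add cls_zero a_ac)
    fix a b :: 'k and A B
    show "a \<odot>\<^bsub>component QP n\<^esub> A \<in> carrier (component QP n)"
      if "A \<in> carrier (component QP n)"
      using that by (auto simp: carrier_cls cls_smult)
    show "(a \<oplus>\<^bsub>ring_of_type_algebra\<^esub> b) \<odot>\<^bsub>component QP n\<^esub> A =
        a \<odot>\<^bsub>component QP n\<^esub> A \<oplus>\<^bsub>component QP n\<^esub> b \<odot>\<^bsub>component QP n\<^esub> A"
      if "A \<in> carrier (component QP n)"
      using that by (auto simp only: carrier_cls cls_smult cls_add smult_l_distr smult_closed UNIV_K)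
    show "a \<odot>\<^bsub>component QP n\<^esub> (A \<oplus>\<^bsub>component QP n\<^esub> B) =
        a \<odot>\<^bsub>component QP n\<^esub> A \<oplus>\<^bsub>component QP n\<^esub> a \<odot>\<^bsub>component QP n\<^esub> B"
      if "A \<in> carrier (component QP n)" "B \<in> carrier (component QP n)"
      using that by (auto simp only: carrier_cls cls_smult cls_add smult_r_distr smult_closed UNIV_K a_closed)
    show "(a \<otimes>\<^bsub>ring_of_type_algebra\<^esub> b) \<odot>\<^bsub>component QP n\<^esub> A =
        a \<odot>\<^bsub>component QP n\<^esub> (b \<odot>\<^bsub>component QP n\<^esub> A)"
      if "A \<in> carrier (component QP n)"
      using that by (auto simp only: carrier_cls cls_smult smult_assoc1 smult_closed UNIV_K)
    show "\<one>\<^bsub>ring_of_type_algebra\<^esub> \<odot>\<^bsub>component QP n\<^esub> A = A"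
      if "A \<in> carrier (component QP n)"
      using that by (auto simp only: carrier_cls cls_smult smult_one)
  qed
qed

theorem quotient_ns_operad: "ns_operad QP"
proof (rule ns_operad.intro, goal_cases)
  case 1 show ?case by (rule quotient_module)
next
  case 2 show ?case using op_id_closed by (auto simp: cls_id carrier_cls)
next
  case (3 i m A B n)
  then show ?case by (auto simp: carrier_cls cls_pcomp intro: pcomp_closed')
next
  case (4 i m A A' B n)
  then obtain x x' y where "x \<in> carrier (component P m)" "x' \<in> carrier (component P m)"
    "y \<in> carrier (component P n)" "A = cls m x" "A' = cls m x'" "B = cls n y"
    by (auto simp: carrier_cls)
  moreover have "x \<oplus>\<^bsub>component P m\<^esub> x' \<in> carrier (component P m)"
    using calculation component_module[of m] by (auto simp: module_def abelian_group_def abelian_monoid.a_closed)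
  ultimately show ?case using 4(1,2) by (simp add: cls_add cls_pcomp pcomp_add_left pcomp_closed')
next
  case (5 i m A B n c)
  then obtain x y where "x \<in> carrier (component P m)" 
    "y \<in> carrier (component P n)" "A = cls m x" "B = cls n y"
    by (auto simp: carrier_cls)
  moreover have "c \<odot>\<^bsub>component P m\<^esub> x \<in> carrier (component P m)"
    using calculation component_module[of m] by (auto intro: module.smult_closed)
  ultimately show ?case using 5(1,2) by (simp add: cls_smult cls_pcomp pcomp_smult_left pcomp_closed')
next
  case (6 i m A B n B')
  then obtain x y y' where "x \<in> carrier (component P m)" "y' \<in> carrier (component P n)"
    "y \<in> carrier (component P n)" "A = cls m x" "B = cls n y" "B' = cls n y'"
    by (auto simp: carrier_cls)
  moreover have "y \<oplus>\<^bsub>component P n\<^esub> y' \<in> carrier (component P n)"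
    using calculation component_module[of n] by (auto simp: module_def abelian_group_def abelian_monoid.a_closed)
  ultimately show ?case using 6(1,2) by (simp add: cls_add cls_pcomp pcomp_add_right pcomp_closed')
next
  case (7 i m A B n c)
  then obtain x y where "x \<in> carrier (component P m)" 
    "y \<in> carrier (component P n)" "A = cls m x" "B = cls n y"
    by (auto simp: carrier_cls)
  moreover have "c \<odot>\<^bsub>component P n\<^esub> y \<in> carrier (component P n)"
    using calculation component_module[of n] by (auto intro: module.smult_closed)
  ultimately show ?case using 7(1,2) by (simp add: cls_smult cls_pcomp pcomp_smult_right pcomp_closed')
next
  case (8 A n)
  then obtain x where x: "x \<in> carrier (component P n)" "A = cls n x" by (auto simp: carrier_cls)
  have "pcomp QP 1 n 1 (cls 1 (op_id P)) (cls n x) = cls (1 + n - 1) (pcomp P 1 n 1 (op_id P) x)"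
    by (intro cls_pcomp op_id_closed x(1)) auto
  then show ?case unfolding cls_id x(2) pcomp_id_left[OF x(1)] by simp
next
  case (9 i n A)
  then obtain x where x: "x \<in> carrier (component P n)" "A = cls n x" by (auto simp: carrier_cls)
  have "pcomp QP n 1 i (cls n x) (cls 1 (op_id P)) = cls (n + 1 - 1) (pcomp P n 1 i x (op_id P))"
    by (intro cls_pcomp op_id_closed x(1) 9(1,2))
  then show ?case unfolding cls_id x(2) pcomp_id_right[OF 9(1,2) x(1)] by simp
next
  case (10 i l j m A B C n)
  then obtain x y z where *: "x \<in> carrier (component P l)" "y \<in> carrier (component P m)"
    "z \<in> carrier (component P n)" "A = cls l x" "B = cls m y" "C = cls n z"
    by (auto simp: carrier_cls)
  have "pcomp QP (l + m - 1) n (i + j - 1) (pcomp QP l m i A B) C =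
      cls (l + m - 1 + n - 1) (pcomp P (l + m - 1) n (i + j - 1) (pcomp P l m i x y) z)"
    using * 10(1-4) pcomp_closed[of i l x y m]
    by (subst cls_pcomp[symmetric]) (simp_all only: *(4-6) cls_pcomp)
  also have "\<dots> = cls (l + (m + n - 1) - 1) (pcomp P l (m + n - 1) i x (pcomp P m n j y z))"
  proof -
    have "l + m - 1 + n - 1 = l + (m + n - 1) - 1" using 10(1-4) by linarith
    then show ?thesis by (simp only: pcomp_sequential[OF 10(1-4) *(1-3)])
  qed
  also have "\<dots> = pcomp QP l (m + n - 1) i A (pcomp QP m n j B C)"
    using * 10(1-4) pcomp_closed[of j m y z n]
    by (subst cls_pcomp[symmetric]) (simp_all only: *(4-6) cls_pcomp)
  finally show ?case .
next
  case (11 i k l A B m C n)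
  then obtain x y z where *: "x \<in> carrier (component P l)" "y \<in> carrier (component P m)"
    "z \<in> carrier (component P n)" "A = cls l x" "B = cls m y" "C = cls n z"
    by (auto simp: carrier_cls)
  have "pcomp QP (l + m - 1) n (k + m - 1) (pcomp QP l m i A B) C =
      cls (l + m - 1 + n - 1) (pcomp P (l + m - 1) n (k + m - 1) (pcomp P l m i x y) z)"
    using * 11(1-3) pcomp_closed[of i l x y m]
    by (subst cls_pcomp[symmetric]) (simp_all only: *(4-6) cls_pcomp)
  also have "\<dots> = cls (l + n - 1 + m - 1) (pcomp P (l + n - 1) m i (pcomp P l n k x z) y)"
  proof -
    have "l + m - 1 + n - 1 = l + n - 1 + m - 1" using 11(1-3) by linarith
    then show ?thesis by (simp only: pcomp_parallel[OF 11(1-3) *(1-3)])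
  qed
  also have "\<dots> = pcomp QP (l + n - 1) m i (pcomp QP l n k A C) B"
    using * 11(1-3) pcomp_closed[of k l x z n]
    by (subst cls_pcomp[symmetric]) (simp_all only: *(4-6) cls_pcomp)
  finally show ?case .
qed

end

section \<open>Universal property of the free operad\<close>

lemma free_pcomp_basis [simp]:
  "pcomp (free_operad ar) m n i (basis_vec s) (basis_vec t) = basis_vec (graft s i t)"
  by (simp add: free_operad_simps)

locale free_lift_locale = ns_operad Q for Q :: "('k::field, 'b) ns_operad" +
  fixes ar :: "'g \<Rightarrow> nat" and \<phi> :: "'g \<Rightarrow> 'b"
  assumes gen_closed: "\<phi> g \<in> carrier (component Q (ar g))"
begin

abbreviation (input) ev :: "'g ptree \<Rightarrow> 'b" where "ev \<equiv> eval_tree Q \<phi>"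
abbreviation (input) br :: "'g ptree list \<Rightarrow> (nat \<times> 'b) list" where
  "br ts \<equiv> map (\<lambda>t. (leaves t, ev t)) ts"

lemma sum_br [simp]: "sum_list (map (fst \<circ> (\<lambda>t. (leaves t, ev t))) ts) = sum_list (map leaves ts)"
  by (simp add: comp_def)

lemma plug_all_closed:
  assumes "\<forall>t\<in>set ts. ev t \<in> carrier (component Q (leaves t))"
    "x \<in> carrier (component Q (q + length ts))"
  shows "plug_all Q (Suc q) x (br ts) \<in> carrier (component Q (q + sum_list (map leaves ts)))"
  using assms
proof (induction ts arbitrary: q)
  case (Cons t ts)
  then have "plug_all Q (Suc (Suc q)) x (br ts) \<in> carrier (component Q (Suc q + sum_list (map leaves ts)))"
    using Cons.IH[of "Suc q"] by simp
  then show ?case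
    using Cons.prems pcomp_closed[of "Suc q" "Suc q + sum_list (map leaves ts)" _ "ev t" "leaves t"]
    by (simp add: add_ac)
qed simp

lemma ev_closed: "wf_tree ar t \<Longrightarrow> ev t \<in> carrier (component Q (leaves t))"
proof (induction t)
  case (Node g ts)
  then show ?case using plug_all_closed[of ts "\<phi> g" 0] gen_closed[of g] by simp
qed (use op_id_closed in simp)

lemma plug_all_graft_forest:
  assumes "\<forall>s\<in>set ss. wf_tree ar s" "wf_tree ar t"
    "\<And>s i. \<lbrakk>s \<in> set ss; 1 \<le> i; i \<le> leaves s\<rbrakk> \<Longrightarrow>
      ev (graft s i t) = pcomp Q (leaves s) (leaves t) i (ev s) (ev t)"
    "x \<in> carrier (component Q (q + length ss))" "1 \<le> i" "i \<le> sum_list (map leaves ss)"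
  shows "plug_all Q (Suc q) x (br (graft_forest ss i t)) =
    pcomp Q (q + sum_list (map leaves ss)) (leaves t) (q + i) (plug_all Q (Suc q) x (br ss)) (ev t)"
  using assms
proof (induction ss arbitrary: i q)
  case (Cons s ss)
  define S where "S = sum_list (map leaves ss)"
  define w where "w = plug_all Q (Suc (Suc q)) x (br ss)"
  have w: "w \<in> carrier (component Q (Suc q + S))"
    unfolding w_def S_def using Cons.prems ev_closed by (intro plug_all_closed) auto
  have s: "ev s \<in> carrier (component Q (leaves s))" and t: "ev t \<in> carrier (component Q (leaves t))"
    using Cons.prems ev_closed by auto
  show ?case
  proof (cases "i \<le> leaves s")
    case True
    have "pcomp Q (Suc q + S + leaves s - 1) (leaves t) (Suc q + i - 1)
          (pcomp Q (Suc q + S) (leaves s) (Suc q) w (ev s)) (ev t) =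
        pcomp Q (Suc q + S) (leaves s + leaves t - 1) (Suc q)
          w (pcomp Q (leaves s) (leaves t) i (ev s) (ev t))"
      using True Cons.prems(5) by (intro pcomp_sequential w s t) auto
    then show ?thesis
      using True Cons.prems(3)[of s i] Cons.prems(5)
      by (simp add: w_def[symmetric] S_def[symmetric] leaves_graft add_ac)
  next
    case False
    have IH: "plug_all Q (Suc (Suc q)) x (br (graft_forest ss (i - leaves s) t)) =
        pcomp Q (Suc q + S) (leaves t) (Suc q + (i - leaves s)) w (ev t)"
      unfolding w_def S_def using False Cons.prems by (intro Cons.IH) auto
    have "pcomp Q (Suc q + S + leaves s - 1) (leaves t) (Suc q + (i - leaves s) + leaves s - 1)
          (pcomp Q (Suc q + S) (leaves s) (Suc q) w (ev s)) (ev t) =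
        pcomp Q (Suc q + S + leaves t - 1) (leaves s) (Suc q)
          (pcomp Q (Suc q + S) (leaves t) (Suc q + (i - leaves s)) w (ev t)) (ev s)"
      using False Cons.prems(6) by (intro pcomp_parallel w s t) (auto simp: S_def)
    moreover have "sum_list (map leaves (graft_forest ss (i - leaves s) t)) = S + leaves t - 1"
      unfolding S_def using False Cons.prems(6) by (intro leaves_graft(2)) auto
    moreover have "S \<ge> 1" using False Cons.prems(6) by (auto simp: S_def)
    ultimately show ?thesis
      using False by (simp add: w_def[symmetric] S_def[symmetric] IH[simplified] add_ac)
  qed
qed simp

lemma ev_graft:
  assumes "wf_tree ar s" "wf_tree ar t" "1 \<le> i" "i \<le> leaves s"
  shows "ev (graft s i t) = pcomp Q (leaves s) (leaves t) i (ev s) (ev t)"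
  using assms
proof (induction s arbitrary: i)
  case Leaf
  then show ?case using pcomp_id_left[OF ev_closed[of t]] by simp
next
  case (Node g ts)
  then show ?case
    using plug_all_graft_forest[of ts t "\<phi> g" 0 i] gen_closed[of g] by simp
qed

abbreviation (input) Fr :: "('k, 'g ptree \<Rightarrow>\<^sub>0 'k) ns_operad" where "Fr \<equiv> free_operad ar"
abbreviation (input) L :: "nat \<Rightarrow> ('g ptree \<Rightarrow>\<^sub>0 'k) \<Rightarrow> 'b" where "L \<equiv> free_lift Q \<phi>"

lemma UNIV_K [simp]: "c \<in> carrier ring_of_type_algebra"
  by (simp add: ring_of_type_algebra_def)

lemma K_simps: "a \<oplus>\<^bsub>ring_of_type_algebra\<^esub> b = a + b" "a \<otimes>\<^bsub>ring_of_type_algebra\<^esub> b = a * b"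
  "\<zero>\<^bsub>ring_of_type_algebra\<^esub> = 0" "\<one>\<^bsub>ring_of_type_algebra\<^esub> = 1"
  by (simp_all add: ring_of_type_algebra_def)

lemma smult_zero [simp]: "x \<in> carrier (component Q n) \<Longrightarrow> 0 \<odot>\<^bsub>component Q n\<^esub> x = \<zero>\<^bsub>component Q n\<^esub>"
  using module.smult_l_null[OF component_module, of x n] by (simp add: K_simps)

lemma lift_superset:
  assumes "x \<in> carrier (component Fr n)" "finite S" "Poly_Mapping.keys x \<subseteq> S"
    "S \<subseteq> {t. wf_tree ar t \<and> leaves t = n}"
  shows "L n x = (\<Oplus>\<^bsub>component Q n\<^esub>t\<in>S. Poly_Mapping.lookup x t \<odot>\<^bsub>component Q n\<^esub> ev t)"
proof -
  interpret module ring_of_type_algebra "component Q n" by (rule component_module)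
  have "ev t \<in> carrier (component Q n)" if "t \<in> S" for t
    using assms(4) that ev_closed[of t] by auto
  then show ?thesis
    unfolding free_lift_def using assms
    by (intro add.finprod_mono_neutral_cong_left) (auto simp: in_keys_iff)
qed

lemma lift_closed: "x \<in> carrier (component Fr n) \<Longrightarrow> L n x \<in> carrier (component Q n)"
proof -
  interpret module ring_of_type_algebra "component Q n" by (rule component_module)
  assume "x \<in> carrier (component Fr n)"
  then have "ev t \<in> carrier (component Q n)" if "t \<in> Poly_Mapping.keys x" for t
    using that ev_closed[of t] by (auto simp: free_operad_simps)
  then show ?thesis unfolding free_lift_def by (intro finsum_closed) auto
qed

lemma lift_add:
  assumes "x \<in> carrier (component Fr n)" "y \<in> carrier (component Fr n)"
  shows "L n (x + y) = L n x \<oplus>\<^bsub>component Q n\<^esub> L n y"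
proof -
  interpret module ring_of_type_algebra "component Q n" by (rule component_module)
  let ?S = "Poly_Mapping.keys x \<union> Poly_Mapping.keys y"
  have S: "?S \<subseteq> {t. wf_tree ar t \<and> leaves t = n}" using assms by (auto simp: free_operad_simps)
  have ev: "ev t \<in> carrier (component Q n)" if "t \<in> ?S" for t
    using S that ev_closed[of t] by auto
  have sup: "L n z = (\<Oplus>\<^bsub>component Q n\<^esub>t\<in>?S. Poly_Mapping.lookup z t \<odot>\<^bsub>component Q n\<^esub> ev t)"
    if "z \<in> {x, y, x + y}" for z
    using that assms S Poly_Mapping.keys_add[of x y]
    by (intro lift_superset) (auto simp: free_operad_simps)
  have "(\<Oplus>\<^bsub>component Q n\<^esub>t\<in>?S. Poly_Mapping.lookup (x + y) t \<odot>\<^bsub>component Q n\<^esub> ev t) =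
      (\<Oplus>\<^bsub>component Q n\<^esub>t\<in>?S. Poly_Mapping.lookup x t \<odot>\<^bsub>component Q n\<^esub> ev t
        \<oplus>\<^bsub>component Q n\<^esub> Poly_Mapping.lookup y t \<odot>\<^bsub>component Q n\<^esub> ev t)"
  proof (intro finsum_cong' refl)
    fix t assume "t \<in> ?S"
    then show "Poly_Mapping.lookup (x + y) t \<odot>\<^bsub>component Q n\<^esub> ev t =
        Poly_Mapping.lookup x t \<odot>\<^bsub>component Q n\<^esub> ev t \<oplus>\<^bsub>component Q n\<^esub> Poly_Mapping.lookup y t \<odot>\<^bsub>component Q n\<^esub> ev t"
      using smult_l_distr[OF UNIV_K UNIV_K ev[of t], of "Poly_Mapping.lookup x t" "Poly_Mapping.lookup y t"]
      by (simp add: lookup_add K_simps)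
  qed (use ev in auto)
  then show ?thesis using ev by (simp add: sup)
qed

lemma lift_smult:
  assumes "x \<in> carrier (component Fr n)"
  shows "L n (pm_scale c x) = c \<odot>\<^bsub>component Q n\<^esub> L n x"
proof -
  interpret module ring_of_type_algebra "component Q n" by (rule component_module)
  let ?S = "Poly_Mapping.keys x"
  have S: "?S \<subseteq> {t. wf_tree ar t \<and> leaves t = n}" using assms by (auto simp: free_operad_simps)
  have ev: "ev t \<in> carrier (component Q n)" if "t \<in> ?S" for t
    using S that ev_closed[of t] by auto
  have "L n (pm_scale c x) = (\<Oplus>\<^bsub>component Q n\<^esub>t\<in>?S. Poly_Mapping.lookup (pm_scale c x) t \<odot>\<^bsub>component Q n\<^esub> ev t)"
    using assms S keys_pm_scale[of c x] by (intro lift_superset) (auto simp: free_operad_simps)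
  also have "\<dots> = (\<Oplus>\<^bsub>component Q n\<^esub>t\<in>?S. c \<odot>\<^bsub>component Q n\<^esub> (Poly_Mapping.lookup x t \<odot>\<^bsub>component Q n\<^esub> ev t))"
  proof (intro finsum_cong' refl)
    fix t assume "t \<in> ?S"
    then show "Poly_Mapping.lookup (pm_scale c x) t \<odot>\<^bsub>component Q n\<^esub> ev t =
        c \<odot>\<^bsub>component Q n\<^esub> (Poly_Mapping.lookup x t \<odot>\<^bsub>component Q n\<^esub> ev t)"
      using smult_assoc1[OF UNIV_K UNIV_K ev[of t], of c "Poly_Mapping.lookup x t"]
      by (simp add: K_simps)
  qed (use ev in auto)
  also have "\<dots> = c \<odot>\<^bsub>component Q n\<^esub> L n x"
    unfolding free_lift_def using ev by (subst finsum_smult_ldistr) auto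
  finally show ?thesis .
qed

lemma lift_basis:
  assumes "wf_tree ar t" "leaves t = n"
  shows "L n (basis_vec t) = ev t"
proof -
  interpret module ring_of_type_algebra "component Q n" by (rule component_module)
  have "ev t \<in> carrier (component Q n)" using assms ev_closed[of t] by auto
  then show ?thesis
    unfolding free_lift_def using smult_one[of "ev t"]
    by (simp add: K_simps) (simp add: basis_vec_def K_simps)
qed

lemma lift_pcomp:
  assumes x: "x \<in> carrier (component Fr m)" and y: "y \<in> carrier (component Fr n)"
    and i: "1 \<le> i" "i \<le> m"
  shows "L (m + n - 1) (pcomp Fr m n i x y) = pcomp Q m n i (L m x) (L n y)"
proof -
  interpret F: ns_operad Fr by (rule free_operad_ns_operad)
  have add: "a \<oplus>\<^bsub>component Fr k\<^esub> b = a + b" and scale: "c \<odot>\<^bsub>component Fr k\<^esub> a = pm_scale c a"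
    and zero: "\<zero>\<^bsub>component Fr k\<^esub> = 0" for a b c k
    by (simp_all add: free_operad_simps)
  have zeroL: "L k 0 = \<zero>\<^bsub>component Q k\<^esub>" for k
    using component_module[of k] 
    by (simp add: free_lift_def module_def abelian_group_def abelian_monoid.finsum_empty)
  have Qz: "\<zero>\<^bsub>component Q k\<^esub> = 0 \<odot>\<^bsub>component Q k\<^esub> \<zero>\<^bsub>component Q k\<^esub>"
    and Qzc: "\<zero>\<^bsub>component Q k\<^esub> \<in> carrier (component Q k)" for k
  proof -
    interpret module ring_of_type_algebra "component Q k" by (rule component_module)
    show "\<zero>\<^bsub>component Q k\<^esub> \<in> carrier (component Q k)" by simp
    then show "\<zero>\<^bsub>component Q k\<^esub> = 0 \<odot>\<^bsub>component Q k\<^esub> \<zero>\<^bsub>component Q k\<^esub>" by simp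
  qed
  have bas: "basis_vec t \<in> carrier (component Fr k)" if "wf_tree ar t" "leaves t = k" for t k
    using that by (simp add: free_operad_simps)
  have sc: "pm_scale c z \<in> carrier (component Fr k)" if "z \<in> carrier (component Fr k)" for c z k
    using that keys_pm_scale[of c z] by (auto simp: free_operad_simps)
  have basis_left: "L (m + n - 1) (pcomp Fr m n i (basis_vec s) y) = pcomp Q m n i (ev s) (L n y)"
    if s: "wf_tree ar s" "leaves s = m" for s
  proof -
    have "Poly_Mapping.keys y \<subseteq> {t. wf_tree ar t \<and> leaves t = n}"
      using y by (simp add: free_operad_simps)
    then show ?thesis
    proof (induction rule: lin_comb_induct)
      case zero
      have "pcomp Q m n i (ev s) \<zero>\<^bsub>component Q n\<^esub> = \<zero>\<^bsub>component Q (m + n - 1)\<^esub>"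
        using pcomp_smult_right[OF i _ Qzc, of "ev s" n 0] Qz[of n] ev_closed[of s] s
          pcomp_closed[OF i _ Qzc, of "ev s" n] by simp
      moreover have "pcomp Fr m n i (basis_vec s) 0 = 0" by (simp add: free_operad_simps)
      ultimately show ?case by (simp add: zeroL)
    next
      case (add c t y)
      have y: "y \<in> carrier (component Fr n)" using add by (simp add: free_operad_simps)
      have t: "wf_tree ar t" "leaves t = n" using add by auto
      have evs: "ev s \<in> carrier (component Q m)" "ev t \<in> carrier (component Q n)"
        using ev_closed s t by auto
      have g: "wf_tree ar (graft s i t)" "leaves (graft s i t) = m + n - 1"
        using s t i by (auto simp: wf_graft leaves_graft)
      have "pcomp Fr m n i (basis_vec s) (pm_scale c (basis_vec t) + y) =
          pm_scale c (basis_vec (graft s i t)) + pcomp Fr m n i (basis_vec s) y"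
        using F.pcomp_add_right[OF i bas[OF s] sc[OF bas[OF t]] y, of c]
          F.pcomp_smult_right[OF i bas[OF s] bas[OF t], of c]
        by (simp add: \<open>\<And>a b k. a \<oplus>\<^bsub>component Fr k\<^esub> b = a + b\<close> scale)
      then have "L (m + n - 1) (pcomp Fr m n i (basis_vec s) (pm_scale c (basis_vec t) + y)) =
          c \<odot>\<^bsub>component Q (m + n - 1)\<^esub> ev (graft s i t) \<oplus>\<^bsub>component Q (m + n - 1)\<^esub> pcomp Q m n i (ev s) (L n y)"
        using lift_add[OF sc[OF bas[OF g]] F.pcomp_closed[OF i bas[OF s] y], of c]
          lift_smult[OF bas[OF g], of c] lift_basis[OF g] add.IH by simp
      also have "ev (graft s i t) = pcomp Q m n i (ev s) (ev t)"
        using ev_graft[of s t i] s t i by simp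
      also have "c \<odot>\<^bsub>component Q (m + n - 1)\<^esub> pcomp Q m n i (ev s) (ev t) \<oplus>\<^bsub>component Q (m + n - 1)\<^esub> pcomp Q m n i (ev s) (L n y)
          = pcomp Q m n i (ev s) (c \<odot>\<^bsub>component Q n\<^esub> ev t \<oplus>\<^bsub>component Q n\<^esub> L n y)"
        using pcomp_smult_right[OF i evs, of c]
          pcomp_add_right[OF i evs(1) module.smult_closed[OF component_module UNIV_K evs(2)] lift_closed[OF y], of c]
        by simp
      also have "c \<odot>\<^bsub>component Q n\<^esub> ev t \<oplus>\<^bsub>component Q n\<^esub> L n y = L n (pm_scale c (basis_vec t) + y)"
        using lift_add[OF sc[OF bas[OF t]] y, of c] lift_smult[OF bas[OF t], of c] lift_basis[OF t] by simp
      finally show ?case .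
    qed
  qed
  have "Poly_Mapping.keys x \<subseteq> {t. wf_tree ar t \<and> leaves t = m}"
    using x by (simp add: free_operad_simps)
  then show ?thesis
  proof (induction rule: lin_comb_induct)
    case zero
    have "pcomp Q m n i \<zero>\<^bsub>component Q m\<^esub> (L n y) = \<zero>\<^bsub>component Q (m + n - 1)\<^esub>"
      using pcomp_smult_left[OF i Qzc lift_closed[OF y], of 0] Qz[of m]
        pcomp_closed[OF i Qzc lift_closed[OF y]] by simp
    moreover have "pcomp Fr m n i 0 y = 0" by (simp add: free_operad_simps)
    ultimately show ?case by (simp add: zeroL)
  next
    case (add c s x)
    have x: "x \<in> carrier (component Fr m)" using add by (simp add: free_operad_simps)
    have s: "wf_tree ar s" "leaves s = m" using add by auto
    have evs: "ev s \<in> carrier (component Q m)" using ev_closed s by auto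
    have p: "pcomp Fr m n i (basis_vec s) y \<in> carrier (component Fr (m + n - 1))"
      by (rule F.pcomp_closed[OF i bas[OF s] y])
    have "pcomp Fr m n i (pm_scale c (basis_vec s) + x) y =
        pm_scale c (pcomp Fr m n i (basis_vec s) y) + pcomp Fr m n i x y"
      using F.pcomp_add_left[OF i sc[OF bas[OF s]] x y, of c]
        F.pcomp_smult_left[OF i bas[OF s] y, of c]
      by (simp add: \<open>\<And>a b k. a \<oplus>\<^bsub>component Fr k\<^esub> b = a + b\<close> scale)
    then have "L (m + n - 1) (pcomp Fr m n i (pm_scale c (basis_vec s) + x) y) =
        c \<odot>\<^bsub>component Q (m + n - 1)\<^esub> pcomp Q m n i (ev s) (L n y)
          \<oplus>\<^bsub>component Q (m + n - 1)\<^esub> pcomp Q m n i (L m x) (L n y)"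
      using lift_add[OF sc[OF p] F.pcomp_closed[OF i x y], of c]
        lift_smult[OF p, of c] basis_left[OF s] add.IH by simp
    also have "\<dots> = pcomp Q m n i (c \<odot>\<^bsub>component Q m\<^esub> ev s \<oplus>\<^bsub>component Q m\<^esub> L m x) (L n y)"
      using pcomp_smult_left[OF i evs lift_closed[OF y], of c]
        pcomp_add_left[OF i module.smult_closed[OF component_module UNIV_K evs] lift_closed[OF x] lift_closed[OF y], of c]
      by simp
    also have "c \<odot>\<^bsub>component Q m\<^esub> ev s \<oplus>\<^bsub>component Q m\<^esub> L m x = L m (pm_scale c (basis_vec s) + x)"
      using lift_add[OF sc[OF bas[OF s]] x, of c] lift_smult[OF bas[OF s], of c] lift_basis[OF s] by simp
    finally show ?case .
  qed
qed

lemma plug_all_id: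
  "x \<in> carrier (component Q (q + k)) \<Longrightarrow> plug_all Q (Suc q) x (replicate k (1, op_id Q)) = x"
proof (induction k arbitrary: q)
  case (Suc k)
  then show ?case
    using pcomp_id_right[of "Suc q" "Suc (q + k)" x] by (simp add: sum_list_replicate)
qed simp

theorem free_lift_hom: "operad_hom Fr Q L"
  unfolding operad_hom_def
  using lift_closed lift_add lift_smult lift_pcomp lift_basis[of Leaf 1]
  by (simp add: free_operad_simps(2,4,6))

theorem free_lift_gen: "L (ar g) (free_gen ar g) = \<phi> g"
proof -
  let ?t = "Node g (replicate (ar g) Leaf)"
  have "wf_tree ar ?t" "leaves ?t = ar g" by (auto simp: sum_list_replicate)
  then have "L (ar g) (free_gen ar g) = ev ?t" unfolding free_gen_def by (rule lift_basis)
  also have "\<dots> = \<phi> g" using plug_all_id[of "\<phi> g" 0 "ar g"] gen_closed[of g] by simp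
  finally show ?thesis .
qed

theorem free_lift_unique:
  assumes f: "operad_hom Fr Q f" and gen: "\<And>g. f (ar g) (free_gen ar g) = \<phi> g"
    and x: "x \<in> carrier (component Fr n)"
  shows "f n x = L n x"
proof -
  have f_add: "f k (a + b) = f k a \<oplus>\<^bsub>component Q k\<^esub> f k b"
    and f_smult: "f k (pm_scale c a) = c \<odot>\<^bsub>component Q k\<^esub> f k a"
    and f_closed: "f k a \<in> carrier (component Q k)"
    if "a \<in> carrier (component Fr k)" "b \<in> carrier (component Fr k)" for a b c k
    using f that by (auto simp: operad_hom_def free_operad_simps(2,4))
  have f_pcomp: "f (l + m - 1) (pcomp Fr l m i a b) = pcomp Q l m i (f l a) (f m b)"
    if "1 \<le> i" "i \<le> l" "a \<in> carrier (component Fr l)" "b \<in> carrier (component Fr m)" for l m i a b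
    using f that unfolding operad_hom_def by blast
  have bas: "basis_vec t \<in> carrier (component Fr k)" if "wf_tree ar t" "leaves t = k" for t k
    using that by (simp add: free_operad_simps)
  have graft_app: "graft_forest (replicate k Leaf @ ss) (Suc k) t = replicate k Leaf @ graft_forest ss 1 t" for k ss t
    by (induction k) auto
  have forest: "f (q + sum_list (map leaves ts)) (basis_vec (Node g (replicate q Leaf @ ts))) =
      plug_all Q (Suc q) (\<phi> g) (br ts)"
    if "\<forall>t\<in>set ts. wf_tree ar t \<and> f (leaves t) (basis_vec t) = ev t" "q + length ts = ar g" for q ts g
    using that
  proof (induction ts arbitrary: q)
    case Nil
    then show ?case using gen[of g] by (simp add: free_gen_def)
  next
    case (Cons t ts)
    let ?s = "Node g (replicate (Suc q) Leaf @ ts)"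
    have s: "wf_tree ar ?s" "leaves ?s = Suc q + sum_list (map leaves ts)"
      using Cons.prems by (auto simp: sum_list_replicate)
    have t: "wf_tree ar t" "f (leaves t) (basis_vec t) = ev t" using Cons.prems by auto
    have gr: "graft ?s (Suc q) t = Node g (replicate q Leaf @ t # ts)"
      using graft_app[of q "Leaf # ts" t] by (simp add: replicate_append_same[symmetric])
    have IH: "f (Suc q + sum_list (map leaves ts)) (basis_vec ?s) = plug_all Q (Suc (Suc q)) (\<phi> g) (br ts)"
      using Cons.prems by (intro Cons.IH) auto
    have "f (Suc q + sum_list (map leaves ts) + leaves t - 1)
        (pcomp Fr (Suc q + sum_list (map leaves ts)) (leaves t) (Suc q) (basis_vec ?s) (basis_vec t)) =
        pcomp Q (Suc q + sum_list (map leaves ts)) (leaves t) (Suc q)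
          (f (Suc q + sum_list (map leaves ts)) (basis_vec ?s)) (f (leaves t) (basis_vec t))"
      using s t by (intro f_pcomp bas) auto
    then show ?case unfolding free_pcomp_basis gr IH t(2) by (simp add: add_ac)
  qed
  have tree: "f (leaves t) (basis_vec t) = ev t" if "wf_tree ar t" for t
    using that
  proof (induction t)
    case Leaf
    then show ?case using f by (simp add: operad_hom_def free_operad_simps)
  next
    case (Node g ts)
    then show ?case using forest[of ts 0 g] by simp
  qed
  have "Poly_Mapping.keys x \<subseteq> {t. wf_tree ar t \<and> leaves t = n}"
    using x by (simp add: free_operad_simps)
  then show ?thesis
  proof (induction rule: lin_comb_induct)
    case zero
    have z: "0 \<in> carrier (component Fr n)" by (simp add: free_operad_simps)
    have "f n (pm_scale 0 0) = \<zero>\<^bsub>component Q n\<^esub>" "L n (pm_scale 0 0) = \<zero>\<^bsub>component Q n\<^esub>"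
      by (simp_all only: f_smult[OF z z] lift_smult[OF z] smult_zero f_closed[OF z z] lift_closed[OF z])
    then show ?case by simp
  next
    case (add c t y)
    have y: "y \<in> carrier (component Fr n)" using add by (simp add: free_operad_simps)
    have t: "wf_tree ar t" "leaves t = n" using add by auto
    have b: "basis_vec t \<in> carrier (component Fr n)" by (rule bas[OF t])
    have cb: "pm_scale c (basis_vec t) \<in> carrier (component Fr n)"
      using b keys_pm_scale[of c "basis_vec t"] by (auto simp: free_operad_simps)
    show ?case
      using f_add[OF cb y] lift_add[OF cb y] f_smult[OF b b] lift_smult[OF b] tree[OF t(1)] lift_basis[OF t] add.IH t(2)
      by simp
  qed
qed

end

section \<open>Well-definedness of the operads and of the homomorphism\<close>

lemma quotient_gen_ns_operad:
  assumes "ns_operad P" "\<And>n. S n \<subseteq> carrier (component P n)"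
  shows "ns_operad (quotient_operad P (operad_ideal_gen P S))"
  using assms
  by (intro ns_operad_ideal.quotient_ns_operad ns_operad_ideal.intro ns_operad_ideal_axioms.intro
      ns_operad.operad_ideal_gen_ideal)

lemma free_gen_closed: "ar g = n \<Longrightarrow> free_gen ar g \<in> carrier (component (free_operad ar) n)"
  by (auto simp: free_gen_def free_operad_simps sum_list_replicate)

lemma free_diff_closed:
  "x \<in> carrier (component (free_operad ar) n) \<Longrightarrow> y \<in> carrier (component (free_operad ar) n) \<Longrightarrow>
    x - y \<in> carrier (component (free_operad ar) n)"
  using Poly_Mapping.keys_diff[of x y] by (auto simp: free_operad_simps)

lemma free_scale_closed:
  "x \<in> carrier (component (free_operad ar) n) \<Longrightarrow> pm_scale c x \<in> carrier (component (free_operad ar) n)"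
  using keys_pm_scale[of c x] by (auto simp: free_operad_simps)

lemma free_pcomp_closed:
  assumes "1 \<le> i" "i \<le> m" "x \<in> carrier (component (free_operad ar) m)"
    "y \<in> carrier (component (free_operad ar) n)" "l = m + n - 1"
  shows "pcomp (free_operad ar) m n i x y \<in> carrier (component (free_operad ar) l)"
  using ns_operad.pcomp_closed[OF free_operad_ns_operad assms(1-4)] assms(5) by simp

lemma relator_eq:
  "relator w = lin_ext (\<lambda>(p, q). basis_vec (Node q [Node p [Leaf, Leaf], Leaf])) (fst w)
    - lin_ext (\<lambda>(p, q). basis_vec (Node p [Leaf, Node q [Leaf, Leaf]])) (snd w)"
  by (simp add: relator_def free_gen_def numeral_2_eq_2)

lemma lin_ext_closed:
  assumes "\<And>b. f b \<in> carrier (component (free_operad ar) n)"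
  shows "lin_ext f x \<in> carrier (component (free_operad ar) n)"
  using assms keys_lin_ext[of f x] unfolding free_operad_simps by blast

lemma relator_closed: "relator w \<in> carrier (component free_binary 3)"
  unfolding relator_eq by (intro free_diff_closed lin_ext_closed) (auto simp: free_operad_simps)

lemma binary_leaves_pos: "wf_tree (\<lambda>_. 2) t \<Longrightarrow> leaves t \<ge> 1"
proof (induction t)
  case (Node g ts)
  then obtain a b where "ts = [a, b]" by (auto simp: length_Suc_conv numeral_2_eq_2)
  then show ?case using Node.IH[of a] Node.prems by simp
qed simp

lemma binary_node: 
  assumes "wf_tree (\<lambda>_. 2) t" "leaves t \<ge> 2"
  obtains g a b where "t = Node g [a, b]" "wf_tree (\<lambda>_. 2) a" "wf_tree (\<lambda>_. 2) b"
    "leaves a \<ge> 1" "leaves b \<ge> 1" "leaves t = leaves a + leaves b"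
proof (cases t)
  case (Node g ts)
  then obtain a b where "ts = [a, b]" using assms by (auto simp: length_Suc_conv numeral_2_eq_2)
  then show ?thesis using that[of g a b] assms Node binary_leaves_pos[of a] binary_leaves_pos[of b] by auto
qed (use assms in auto)

lemma binary_one: "wf_tree (\<lambda>_. 2) t \<Longrightarrow> leaves t = 1 \<Longrightarrow> t = Leaf"
proof (rule ccontr)
  assume t: "wf_tree (\<lambda>_. 2) t" "leaves t = 1" "t \<noteq> Leaf"
  then obtain g a b where "t = Node g [a, b]" by (cases t) (auto simp: length_Suc_conv numeral_2_eq_2)
  then show False using t binary_leaves_pos[of a] binary_leaves_pos[of b] by auto
qed

lemma binary_two:
  assumes "wf_tree (\<lambda>_. 2) t" "leaves t = 2"
  obtains g where "t = Node g [Leaf, Leaf]"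
proof -
  obtain g a b where t: "t = Node g [a, b]" "wf_tree (\<lambda>_. 2) a" "wf_tree (\<lambda>_. 2) b"
    "leaves a \<ge> 1" "leaves b \<ge> 1" "leaves t = leaves a + leaves b"
    using binary_node[of t] assms by auto
  then have "leaves a = 1" "leaves b = 1" using assms by auto
  then show ?thesis using that t binary_one by blast
qed

lemma binary_three:
  assumes "wf_tree (\<lambda>_. 2) t" "leaves t = 3"
  obtains p q where "t = Node q [Node p [Leaf, Leaf], Leaf]"
  | p q where "t = Node p [Leaf, Node q [Leaf, Leaf]]"
proof -
  obtain g a b where t: "t = Node g [a, b]" "wf_tree (\<lambda>_. 2) a" "wf_tree (\<lambda>_. 2) b"
    "leaves a \<ge> 1" "leaves b \<ge> 1" "leaves t = leaves a + leaves b"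
    using binary_node[of t] assms by auto
  then consider "leaves a = 2" "leaves b = 1" | "leaves a = 1" "leaves b = 2" using assms by linarith
  then show ?thesis
  proof cases
    case 1 then show ?thesis using that t binary_one[of b] binary_two[of a] by metis
  next
    case 2 then show ?thesis using that t binary_one[of a] binary_two[of b] by metis
  qed
qed

lemma lookup_lin_ext_basis_inj:
  assumes "inj f"
  shows "Poly_Mapping.lookup (lin_ext (\<lambda>b. basis_vec (f b)) x) (f b) = Poly_Mapping.lookup x b"
proof -
  have "Poly_Mapping.lookup (lin_ext (\<lambda>b. basis_vec (f b)) x) (f b) =
     (\<Sum>b'\<in>Poly_Mapping.keys x. if b' = b then Poly_Mapping.lookup x b else 0)"
    unfolding lin_ext_def lookup_sum using assms
    by (intro sum.cong) (auto simp: basis_vec_def lookup_single inj_eq)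
  then show ?thesis by (simp add: sum.delta' in_keys_iff)
qed

lemma lookup_lin_ext_basis_notin:
  "t \<notin> range f \<Longrightarrow> Poly_Mapping.lookup (lin_ext (\<lambda>b. basis_vec (f b)) x) t = 0"
  unfolding lin_ext_def lookup_sum
  by (intro sum.neutral) (auto simp: basis_vec_def lookup_single when_def)

theorem relator_bij:
  "bij_betw (relator :: ('g, 'k::field) quadratic \<Rightarrow> _) UNIV (carrier (component free_binary 3))"
proof (rule bij_betwI')
  let ?l = "\<lambda>(p :: 'g, q). Node q [Node p [Leaf, Leaf], Leaf]"
  let ?r = "\<lambda>(p :: 'g, q). Node p [Leaf, Node q [Leaf, Leaf]]"
  have rel: "relator w = lin_ext (\<lambda>b. basis_vec (?l b)) (fst w) - lin_ext (\<lambda>b. basis_vec (?r b)) (snd w)" for w :: "('g, 'k) quadratic"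
    unfolding relator_eq by (simp add: case_prod_unfold)
  have inj: "inj ?l" "inj ?r" by (auto intro!: injI)
  have ni: "?l b \<notin> range ?r" "?r b \<notin> range ?l" for b by (auto split: prod.splits)
  have lk: "Poly_Mapping.lookup (relator w) (?l b) = Poly_Mapping.lookup (fst w) b"
    "Poly_Mapping.lookup (relator w) (?r b) = - Poly_Mapping.lookup (snd w) b" for w :: "('g, 'k) quadratic" and b
    unfolding rel lookup_minus
    by (simp_all only: lookup_lin_ext_basis_inj[OF inj(1)] lookup_lin_ext_basis_inj[OF inj(2)]
      lookup_lin_ext_basis_notin[OF ni(1)] lookup_lin_ext_basis_notin[OF ni(2)] diff_0_right diff_0)
  show "relator x = relator y \<longleftrightarrow> x = y" for x y :: "('g, 'k) quadratic"
  proof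
    assume eq: "relator x = relator y"
    have "fst x = fst y" using lk(1)[of x] lk(1)[of y] eq by (intro poly_mapping_eqI) metis
    moreover have "snd x = snd y" using lk(2)[of x] lk(2)[of y] eq
      by (intro poly_mapping_eqI) (metis neg_equal_iff_equal)
    ultimately show "x = y" by (rule prod_eqI)
  qed simp
  show "relator x \<in> carrier (component free_binary 3)" for x :: "('g, 'k) quadratic" by (rule relator_closed)
  show "\<exists>x\<in>UNIV. y = relator x" if "y \<in> carrier (component free_binary 3)"
    for y :: "'g ptree \<Rightarrow>\<^sub>0 'k"
  proof -
    have "Poly_Mapping.keys y \<subseteq> {t. wf_tree (\<lambda>_. 2) t \<and> leaves t = 3}"
      using that by (simp add: free_operad_simps)
    then show ?thesis
    proof (induction rule: lin_comb_induct)
      case zero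
      show ?case by (intro bexI[of _ "(0, 0)"]) (simp_all add: rel)
    next
      case (add c t y)
      then obtain w where w: "y = relator w" by auto
      from add have "wf_tree (\<lambda>_. 2) t" "leaves t = 3" by auto
      then show ?case
      proof (cases rule: binary_three)
        case (1 p q)
        have "pm_scale c (basis_vec t) + y = relator (pm_scale c (basis_vec (p, q)) + fst w, snd w)"
          unfolding w rel by (simp add: lin_ext_add lin_ext_scale 1)
        then show ?thesis by blast
      next
        case (2 p q)
        have "pm_scale c (basis_vec t) + y = relator (fst w, pm_scale (- c) (basis_vec (p, q)) + snd w)"
          unfolding w rel using pm_scale_minus[of "pm_scale c (basis_vec t)"]
          by (simp add: lin_ext_add lin_ext_scale 2)
        then show ?thesis by blast
      qed
    qed
  qed
qed

theorem binary_operad_ns_operad: "ns_operad (binary_operad \<Lambda>)"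
  unfolding binary_operad_def
  by (intro quotient_gen_ns_operad free_operad_ns_operad) (auto simp: relator_closed)

lemma ERB_ideal: "operad_ideal free_rb (ERB_ideal lam kap)"
  unfolding ERB_ideal_def ERB_relator_def assoc_relator_def
  by (intro ns_operad.operad_ideal_gen_ideal free_operad_ns_operad)
    (auto intro!: free_diff_closed free_scale_closed free_pcomp_closed free_gen_closed)

theorem ERB_ns_operad: "ns_operad (ERB lam kap)"
  unfolding ERB_def
  by (intro ns_operad_ideal.quotient_ns_operad ns_operad_ideal.intro ns_operad_ideal_axioms.intro
      free_operad_ns_operad ERB_ideal)

lemma ERB_gen_closed:
  "ERB_rho lam kap \<in> carrier (component (ERB lam kap) 1)"
  "ERB_mu lam kap \<in> carrier (component (ERB lam kap) 2)"
  unfolding ERB_rho_def ERB_mu_def ERB_def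
  by (intro ns_operad_ideal.cls_in_carrier ns_operad_ideal.intro ns_operad_ideal_axioms.intro
      free_operad_ns_operad ERB_ideal free_gen_closed; simp)+

theorem dc_hom_unique:
  assumes "ns_operad Q" "r \<in> carrier (component Q 1)" "m \<in> carrier (component Q 2)"
  shows "is_dc_hom Q r m (dc_hom Q r m)"
    and "\<lbrakk>is_dc_hom Q r m \<Psi>; x \<in> carrier (component free_binary n)\<rbrakk> \<Longrightarrow> \<Psi> n x = dc_hom Q r m n x"
proof -
  interpret ns_operad Q by fact
  let ?\<phi> = "\<lambda>g. case g of Prec \<Rightarrow> pcomp Q 2 1 2 m r | Succ \<Rightarrow> pcomp Q 2 1 1 m r"
  have "?\<phi> g \<in> carrier (component Q 2)" for g
    using pcomp_closed[of 1 2 m r 1] pcomp_closed[of 2 2 m r 1] assms by (cases g) auto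
  then interpret L: free_lift_locale Q "\<lambda>_. 2" ?\<phi>
    by unfold_locales
  show "is_dc_hom Q r m (dc_hom Q r m)"
    unfolding is_dc_hom_def dc_hom_def
    using L.free_lift_hom L.free_lift_gen[of Prec] L.free_lift_gen[of Succ] by (simp only: dend.case simp_thms)
  show "\<Psi> n x = dc_hom Q r m n x"
    if "is_dc_hom Q r m \<Psi>" "x \<in> carrier (component free_binary n)"
  proof -
    have "\<Psi> 2 (free_gen (\<lambda>_. 2) g) = ?\<phi> g" for g
      using that(1) by (cases g) (auto simp: is_dc_hom_def)
    then show ?thesis unfolding dc_hom_def
      using that by (intro L.free_lift_unique) (auto simp: is_dc_hom_def)
  qed
qed

end

theory Submission
  imports Defs "HOL-Library.Function_Algebras"
begin

text \<open>
  Write \<open>\<rho>\<close> for the operator and \<open>xy\<close> for the associative product of an extended Rota-Baxter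
  algebra.  Under \<open>\<Psi>\<close>, the eight quadratic trees on \<open>\<prec>\<close> and \<open>\<succ>\<close> become \<open>x\<rho>(y)\<rho>(z)\<close>, \<open>\<rho>(x\<rho>(y))z\<close>,
  \<open>\<rho>(x)y\<rho>(z)\<close>, \<open>\<rho>(\<rho>(x)y)z\<close> and \<open>x\<rho>(y\<rho>(z))\<close>, \<open>x\<rho>(\<rho>(y)z)\<close>, \<open>\<rho>(x)y\<rho>(z)\<close>, \<open>\<rho>(x)\<rho>(y)z\<close>.  The extended
  Rota-Baxter identity rewrites the first one, \<open>x\<rho>(y)\<rho>(z)\<close>, and the last one, \<open>\<rho>(x)\<rho>(y)z\<close>, through the
  other ones and the monomials \<open>x\<rho>(yz)\<close>, \<open>\<rho>(xy)z\<close>, \<open>xyz\<close>, with coefficients involving \<open>\<lambda>\<close> and \<open>\<kappa>\<close>.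
  As the other ones and these three monomials are linearly independent, a relation lies in the
  kernel exactly when it is an extended dendriform relation, the conditions \<open>\<lambda>a = \<lambda>c = 0\<close> and
  \<open>\<kappa>(a - c) = 0\<close> expressing that the three monomials cancel.

  The inclusion of the dendriform relations in the kernel is an explicit combination of the
  defining relators (\<open>rb_relator_ED_in_ideal\<close>).

  For the converse, a relation in the kernel is tested in sufficiently many extended Rota-Baxter
  algebras: the operations that vanish on an algebra form an operadic ideal, which contains the
  defining relators (\<open>identities_ideal\<close>, \<open>ERB_ideal_subset_identities\<close>).  A Schur multiplier
  \<open>A\<^sub>i\<^sub>j \<mapsto> s\<^sub>i\<^sub>j A\<^sub>i\<^sub>j\<close> on strictly upper triangular matrices satisfies the extended Rota-Baxter identity
  when \<open>s\<^sub>i\<^sub>j s\<^sub>j\<^sub>k = (s\<^sub>i\<^sub>j + s\<^sub>j\<^sub>k + \<lambda>) s\<^sub>i\<^sub>k + \<kappa>\<close> for \<open>i < j < k\<close> (\<open>schur_extended_rota_baxter_algebra\<close>), and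
  for matrices of size four these equations have a rational family of solutions with three free
  parameters (\<open>spectrum_relation\<close>).  Evaluated on three consecutive matrix units, a relation becomes a
  rational identity in the parameters.  Over a field of characteristic zero it can be compared
  coefficient by coefficient, which leaves exactly the dendriform relations
  (\<open>kernel_coefficients\<close>, \<open>ED_if_rb_relator_in_ideal\<close>).
\<close>

section \<open>Evaluating operations in an extended Rota-Baxter algebra\<close>

text \<open>
  The operad of extended Rota-Baxter algebras acts on every such algebra, so a combination of trees
  that does not vanish as an operation on one algebra is nonzero in the operad.  This is
  how independence of operations is detected.
\<close>

locale extended_rota_baxter_algebra = vector_space scale
  for scale :: "'k::field \<Rightarrow> 'a::ab_group_add \<Rightarrow> 'a" (infixr \<open>*s\<close> 75) +
  fixes M :: "'a \<Rightarrow> 'a \<Rightarrow> 'a" (infixl \<open>\<cdot>\<close> 70) and R :: "'a \<Rightarrow> 'a" and lam kap :: 'k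
  assumes M_add_left: "(x + y) \<cdot> z = x \<cdot> z + y \<cdot> z"
    and M_add_right: "x \<cdot> (y + z) = x \<cdot> y + x \<cdot> z"
    and M_scale_left: "(c *s x) \<cdot> y = c *s (x \<cdot> y)"
    and M_scale_right: "x \<cdot> (c *s y) = c *s (x \<cdot> y)"
    and R_add: "R (x + y) = R x + R y"
    and R_scale: "R (c *s x) = c *s R x"
    and assoc: "(x \<cdot> y) \<cdot> z = x \<cdot> (y \<cdot> z)"
    and rota_baxter: "R x \<cdot> R y = R (x \<cdot> R y) + R (R x \<cdot> y) + lam *s R (x \<cdot> y) + kap *s (x \<cdot> y)"

text \<open>
  The inputs of an operation are read from a sequence, whose first entries go to the leaves from the
  left; the remaining entries are ignored.
  With sequences instead of lists of a fixed length, composition needs no length conditions.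
\<close>

fun rb_tree_eval :: "('a \<Rightarrow> 'a \<Rightarrow> 'a) \<Rightarrow> ('a \<Rightarrow> 'a) \<Rightarrow> rb ptree \<Rightarrow> (nat \<Rightarrow> 'a) \<Rightarrow> 'a" where
  "rb_tree_eval m r Leaf e = e 0"
| "rb_tree_eval m r (Node Rho [t]) e = r (rb_tree_eval m r t e)"
| "rb_tree_eval m r (Node Mu [s, t]) e =
    m (rb_tree_eval m r s e) (rb_tree_eval m r t (\<lambda>j. e (j + leaves s)))"

lemma rb_tree_induct [consumes 1, case_names Leaf Rho Mu]:
  assumes "wf_tree rb_arity t" "P Leaf"
    and "\<And>t. wf_tree rb_arity t \<Longrightarrow> P t \<Longrightarrow> P (Node Rho [t])"
    and "\<And>s t. \<lbrakk>wf_tree rb_arity s; wf_tree rb_arity t; P s; P t\<rbrakk> \<Longrightarrow> P (Node Mu [s, t])"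
  shows "P t"
  using assms(1)
proof (induction t)
  case (Node g ts)
  show ?case
  proof (cases g)
    case Rho
    then obtain t where "ts = [t]" using Node.prems by (auto simp: length_Suc_conv)
    then show ?thesis using Node Rho assms(3) by auto
  next
    case Mu
    then obtain s t where "ts = [s, t]" using Node.prems by (auto simp: length_Suc_conv numeral_2_eq_2)
    then show ?thesis using Node Mu assms(4) by auto
  qed
qed (rule assms(2))

text \<open>
  The inputs that \<open>s\<close> sees after grafting an operation of arity \<open>n\<close> onto its leaf number \<open>k\<close>, counted
  from \<open>0\<close>: the grafted operation consumes \<open>n\<close> inputs and leaves its value \<open>a\<close> in place of them.
\<close>

definition plug_env :: "nat \<Rightarrow> nat \<Rightarrow> 'a \<Rightarrow> (nat \<Rightarrow> 'a) \<Rightarrow> nat \<Rightarrow> 'a" where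
  "plug_env k n a e = (\<lambda>j. if j < k then e j else if j = k then a else e (j + n - 1))"

lemma rb_tree_eval_cong:
  assumes "wf_tree rb_arity t" "\<And>j. j < leaves t \<Longrightarrow> e j = e' j"
  shows "rb_tree_eval m r t e = rb_tree_eval m r t e'"
  using assms
proof (induction arbitrary: e e' rule: rb_tree_induct)
  case Leaf then show ?case by simp
next
  case (Rho t)
  show ?case using Rho.IH[of e e'] Rho.prems by simp
next
  case (Mu s t)
  show ?case
    using Mu.IH(1)[of e e'] Mu.IH(2)[of "\<lambda>j. e (j + leaves s)" "\<lambda>j. e' (j + leaves s)"] Mu.prems
    by simp
qed

lemma plug_env_before: "j < k \<Longrightarrow> plug_env k n a e j = e j"
  by (simp add: plug_env_def)

lemma plug_env_shift:
  "k < l \<Longrightarrow> (\<lambda>j. plug_env k n a e (j + l)) = (\<lambda>j. e (j + (l + n - 1)))"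
  "l \<le> k \<Longrightarrow> (\<lambda>j. plug_env k n a e (j + l)) = plug_env (k - l) n a (\<lambda>j. e (j + l))"
  by (auto simp: plug_env_def fun_eq_iff add_ac)

lemma rb_tree_eval_plug_env_after:
  "wf_tree rb_arity s \<Longrightarrow> leaves s \<le> k \<Longrightarrow> rb_tree_eval m r s (plug_env k n a e) = rb_tree_eval m r s e"
  by (intro rb_tree_eval_cong) (auto simp: plug_env_before)

lemma rb_tree_eval_graft:
  assumes "wf_tree rb_arity s" "k < leaves s"
  shows "rb_tree_eval m r (graft s (Suc k) t) e =
    rb_tree_eval m r s (plug_env k (leaves t) (rb_tree_eval m r t (\<lambda>j. e (j + k))) e)"
  using assms
proof (induction arbitrary: k e rule: rb_tree_induct)
  case Leaf
  then show ?case by (simp add: plug_env_def)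
next
  case (Rho s)
  then show ?case by simp
next
  case (Mu s s')
  show ?case
  proof (cases "k < leaves s")
    case True
    then show ?thesis using Mu.IH(1)[of k e] by (simp add: leaves_graft plug_env_shift)
  next
    case False
    then have "Suc k - leaves s = Suc (k - leaves s)" "k - leaves s < leaves s'"
      using Mu.prems by auto
    then show ?thesis
      using False Mu.hyps Mu.IH(2)[of "k - leaves s" "\<lambda>j. e (j + leaves s)"]
      by (simp add: plug_env_shift rb_tree_eval_plug_env_after)
  qed
qed

context extended_rota_baxter_algebra
begin

abbreviation (input) tree_eval :: "rb ptree \<Rightarrow> (nat \<Rightarrow> 'a) \<Rightarrow> 'a" where
  "tree_eval \<equiv> rb_tree_eval M R"

definition op_eval :: "(rb ptree \<Rightarrow>\<^sub>0 'k) \<Rightarrow> (nat \<Rightarrow> 'a) \<Rightarrow> 'a" where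
  "op_eval x e = (\<Sum>t\<in>Poly_Mapping.keys x. Poly_Mapping.lookup x t *s tree_eval t e)"

lemma op_eval_superset:
  "finite S \<Longrightarrow> Poly_Mapping.keys x \<subseteq> S \<Longrightarrow>
    op_eval x e = (\<Sum>t\<in>S. Poly_Mapping.lookup x t *s tree_eval t e)"
  unfolding op_eval_def by (intro sum.mono_neutral_left) (auto simp: in_keys_iff)

lemma op_eval_zero [simp]: "op_eval 0 e = 0"
  by (simp add: op_eval_def)

lemma op_eval_basis [simp]: "op_eval (basis_vec t) e = tree_eval t e"
  by (simp add: op_eval_def) (simp add: basis_vec_def)

lemma op_eval_add: "op_eval (x + y) e = op_eval x e + op_eval y e"
proof -
  let ?S = "Poly_Mapping.keys x \<union> Poly_Mapping.keys y"
  have "op_eval z e = (\<Sum>t\<in>?S. Poly_Mapping.lookup z t *s tree_eval t e)" if "z \<in> {x, y, x + y}" for z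
    using that Poly_Mapping.keys_add[of x y] by (intro op_eval_superset) auto
  then show ?thesis by (simp add: lookup_add scale_left_distrib sum.distrib)
qed

lemma op_eval_scale: "op_eval (pm_scale c x) e = c *s op_eval x e"
  by (subst op_eval_superset[of "Poly_Mapping.keys x"])
    (auto simp: keys_pm_scale scale_sum_right op_eval_def)

lemma op_eval_diff: "op_eval (x - y) e = op_eval x e - op_eval y e"
  using op_eval_add[of x "- y" e] op_eval_scale[of "-1" y e] by (simp add: pm_scale_minus)

lemma op_eval_sum: "op_eval (sum f A) e = (\<Sum>a\<in>A. op_eval (f a) e)"
  by (induction A rule: infinite_finite_induct) (auto simp: op_eval_add)

lemma op_eval_lin_ext:
  "op_eval (lin_ext f x) e = (\<Sum>b\<in>Poly_Mapping.keys x. Poly_Mapping.lookup x b *s op_eval (f b) e)"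
  by (simp add: lin_ext_def op_eval_sum op_eval_scale)

lemma tree_eval_slot_linear:
  assumes "wf_tree rb_arity s" "k < leaves s"
  shows tree_eval_slot_add: "tree_eval s (plug_env k n (a + b) e) =
      tree_eval s (plug_env k n a e) + tree_eval s (plug_env k n b e)"
    and tree_eval_slot_scale: "tree_eval s (plug_env k n (c *s a) e) = c *s tree_eval s (plug_env k n a e)"
proof -
  have "tree_eval s (plug_env k n (a + b) e) = tree_eval s (plug_env k n a e) + tree_eval s (plug_env k n b e) \<and>
      tree_eval s (plug_env k n (c *s a) e) = c *s tree_eval s (plug_env k n a e)"
    using assms
  proof (induction arbitrary: k e rule: rb_tree_induct)
    case Leaf
    then show ?case by (simp add: plug_env_def)
  next
    case (Rho s)
    then show ?case by (simp add: R_add R_scale)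
  next
    case (Mu s s')
    show ?case
    proof (cases "k < leaves s")
      case True
      then show ?thesis
        using Mu.IH(1)[of k e] by (simp add: plug_env_shift M_add_left M_scale_left)
    next
      case False
      then have "k - leaves s < leaves s'" using Mu.prems by auto
      then show ?thesis
        using False Mu.hyps Mu.IH(2)[of "k - leaves s" "\<lambda>j. e (j + leaves s)"]
        by (simp add: plug_env_shift rb_tree_eval_plug_env_after M_add_right M_scale_right)
    qed
  qed
  then show "tree_eval s (plug_env k n (a + b) e) =
      tree_eval s (plug_env k n a e) + tree_eval s (plug_env k n b e)"
    and "tree_eval s (plug_env k n (c *s a) e) = c *s tree_eval s (plug_env k n a e)"
    by auto
qed

lemma tree_eval_slot_zero:
  "wf_tree rb_arity s \<Longrightarrow> k < leaves s \<Longrightarrow> tree_eval s (plug_env k n 0 e) = 0"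
  using tree_eval_slot_scale[of s k n 0 0 e] by simp

lemma tree_eval_slot_sum:
  assumes "wf_tree rb_arity s" "k < leaves s"
  shows "tree_eval s (plug_env k n (\<Sum>b\<in>B. c b *s f b) e) = (\<Sum>b\<in>B. c b *s tree_eval s (plug_env k n (f b) e))"
  by (induction B rule: infinite_finite_induct)
    (simp_all add: tree_eval_slot_zero[OF assms] tree_eval_slot_linear[OF assms])

text \<open>
  Partial composition becomes substitution.  The reduction to trees uses that a tree acts
  multilinearly: each leaf is one slot, and product and operator are linear in each argument.
\<close>

lemma op_eval_pcomp:
  assumes x: "x \<in> carrier (component free_rb m)" and y: "y \<in> carrier (component free_rb n)" and k: "k < m"
  shows "op_eval (pcomp free_rb m n (Suc k) x y) e =
    op_eval x (plug_env k n (op_eval y (\<lambda>j. e (j + k))) e)"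
proof -
  have "op_eval (pcomp free_rb m n (Suc k) x y) e = (\<Sum>s\<in>Poly_Mapping.keys x. Poly_Mapping.lookup x s *s
      (\<Sum>t\<in>Poly_Mapping.keys y. Poly_Mapping.lookup y t *s tree_eval (graft s (Suc k) t) e))"
    by (simp add: free_operad_simps op_eval_lin_ext)
  also have "\<dots> = (\<Sum>s\<in>Poly_Mapping.keys x. Poly_Mapping.lookup x s *s
      tree_eval s (plug_env k n (op_eval y (\<lambda>j. e (j + k))) e))"
  proof (intro sum.cong refl arg_cong2[of _ _ _ _ scale])
    fix s assume "s \<in> Poly_Mapping.keys x"
    then have s: "wf_tree rb_arity s" "k < leaves s" using x k by (auto simp: free_operad_simps)
    have "(\<Sum>t\<in>Poly_Mapping.keys y. Poly_Mapping.lookup y t *s tree_eval (graft s (Suc k) t) e) =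
      (\<Sum>t\<in>Poly_Mapping.keys y. Poly_Mapping.lookup y t *s
        tree_eval s (plug_env k n (tree_eval t (\<lambda>j. e (j + k))) e))"
      using y by (intro sum.cong refl) (auto simp: free_operad_simps rb_tree_eval_graft[OF s])
    then show "(\<Sum>t\<in>Poly_Mapping.keys y. Poly_Mapping.lookup y t *s tree_eval (graft s (Suc k) t) e) =
        tree_eval s (plug_env k n (op_eval y (\<lambda>j. e (j + k))) e)"
      by (simp add: op_eval_def tree_eval_slot_sum[OF s])
  qed
  finally show ?thesis by (simp add: op_eval_def)
qed

text \<open>
  In degree \<open>n\<close>, the kernel of the homomorphism from the free operad to the endomorphism operad of the
  algebra.
\<close>

definition identities :: "nat \<Rightarrow> (rb ptree \<Rightarrow>\<^sub>0 'k) set" where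
  "identities n = {x \<in> carrier (component free_rb n). \<forall>e. op_eval x e = 0}"

lemma identities_ideal: "operad_ideal free_rb identities"
proof -
  have "submodule (identities n) ring_of_type_algebra (component free_rb n)" for n
  proof (rule module.submoduleI[OF free_operad_module])
    interpret F: module "ring_of_type_algebra :: 'k ring" "component free_rb n" by (rule free_operad_module)
    show "identities n \<subseteq> carrier (component free_rb n)" by (auto simp: identities_def)
    show "\<zero>\<^bsub>component free_rb n\<^esub> \<in> identities n"
      using F.zero_closed by (simp add: identities_def free_operad_simps(3))
    show "a \<oplus>\<^bsub>component free_rb n\<^esub> b \<in> identities n" if "a \<in> identities n" "b \<in> identities n" for a b
      using that F.a_closed[of a b] by (simp add: identities_def free_operad_simps(2) op_eval_add)
    show "c \<odot>\<^bsub>component free_rb n\<^esub> a \<in> identities n" if "a \<in> identities n" for c a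
      using that free_scale_closed[of a rb_arity n c] by (simp add: identities_def free_operad_simps(4) op_eval_scale)
    show "\<ominus>\<^bsub>component free_rb n\<^esub> a \<in> identities n" if a: "a \<in> identities n" for a
    proof -
      have ac: "a \<in> carrier (component free_rb n)" using a by (simp add: identities_def)
      have "a \<oplus>\<^bsub>component free_rb n\<^esub> (\<ominus>\<^bsub>component free_rb n\<^esub> a) = \<zero>\<^bsub>component free_rb n\<^esub>"
        by (rule F.r_neg[OF ac])
      then have "\<ominus>\<^bsub>component free_rb n\<^esub> a = - a"
        by (simp add: free_operad_simps(2,3) eq_neg_iff_add_eq_0 add.commute)
      then show ?thesis
        using a F.a_inv_closed[OF ac] op_eval_diff[of 0 a] by (simp add: identities_def)
    qed
  qed
  moreover have "pcomp free_rb m n i x y \<in> identities (m + n - 1)"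
    if i: "1 \<le> i" "i \<le> m" and xy: "x \<in> carrier (component free_rb m)" "y \<in> carrier (component free_rb n)"
      and z: "x \<in> identities m \<or> y \<in> identities n" for m n i x y
  proof -
    obtain k where k: "i = Suc k" "k < m" using i by (cases i) auto
    have "op_eval (pcomp free_rb m n (Suc k) x y) e = 0" for e
    proof (cases "x \<in> identities m")
      case True
      then show ?thesis by (simp add: op_eval_pcomp[OF xy k(2)] identities_def)
    next
      case False
      then have "y \<in> identities n" using z by blast
      then have "op_eval y e' = 0" for e' by (simp add: identities_def)
      moreover have "tree_eval s (plug_env k n 0 e) = 0" if "s \<in> Poly_Mapping.keys x" for s
        using that xy k by (intro tree_eval_slot_zero) (auto simp: free_operad_simps)
      ultimately show ?thesis by (simp add: op_eval_pcomp[OF xy k(2)] op_eval_def[of x])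
    qed
    then show ?thesis
      using free_pcomp_closed[OF i xy refl] k(1) by (simp add: identities_def)
  qed
  moreover have "x \<in> carrier (component free_rb n)" if "x \<in> identities n" for x n
    using that by (simp add: identities_def)
  ultimately show ?thesis unfolding operad_ideal_def by blast
qed

lemma ERB_ideal_subset_identities: "ERB_ideal lam kap n \<subseteq> identities n"
  unfolding ERB_ideal_def
proof (rule operad_ideal_gen_least[OF identities_ideal])
  have "assoc_relator \<in> carrier (component free_rb 3)"
    unfolding assoc_relator_def by (auto intro!: free_diff_closed free_pcomp_closed free_gen_closed)
  then have "assoc_relator \<in> identities 3"
    unfolding identities_def
    by (simp add: assoc_relator_def op_eval_diff free_gen_def numeral_2_eq_2 assoc)
  moreover have "ERB_relator lam kap \<in> carrier (component free_rb 2)"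
    unfolding ERB_relator_def
    by (auto intro!: free_diff_closed free_scale_closed free_pcomp_closed free_gen_closed)
  then have "ERB_relator lam kap \<in> identities 2"
    unfolding identities_def
    by (simp add: ERB_relator_def op_eval_diff op_eval_scale free_gen_def numeral_2_eq_2 rota_baxter)
  ultimately show "(if m = 2 then {ERB_relator lam kap} else if m = 3 then {assoc_relator} else {})
      \<subseteq> identities m" for m
    by auto
qed

end

section \<open>Schur multipliers on strictly upper triangular matrices\<close>

definition mat_scale :: "'k::field \<Rightarrow> (nat \<Rightarrow> nat \<Rightarrow> 'k) \<Rightarrow> nat \<Rightarrow> nat \<Rightarrow> 'k" where
  "mat_scale c A = (\<lambda>i j. c * A i j)"

text \<open>
  The sum runs over \<open>i < j < k\<close> only, so this is the product of strictly upper triangular matrices with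
  indices \<open>0, \<dots>, n\<close>, extended to arbitrary arrays, whose other entries never
  enter a product.
\<close>

definition strict_mult :: "nat \<Rightarrow> (nat \<Rightarrow> nat \<Rightarrow> 'k::field) \<Rightarrow> (nat \<Rightarrow> nat \<Rightarrow> 'k) \<Rightarrow> nat \<Rightarrow> nat \<Rightarrow> 'k" where
  "strict_mult n A B = (\<lambda>i k. if k \<le> n then \<Sum>j\<in>{i<..<k}. A i j * B j k else 0)"

definition schur_mult :: "(nat \<Rightarrow> nat \<Rightarrow> 'k::field) \<Rightarrow> (nat \<Rightarrow> nat \<Rightarrow> 'k) \<Rightarrow> nat \<Rightarrow> nat \<Rightarrow> 'k" where
  "schur_mult s A = (\<lambda>i j. s i j * A i j)"

lemma strict_mult_assoc:
  "strict_mult n (strict_mult n A B) C = strict_mult n A (strict_mult n B C)"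
proof (intro ext)
  fix i l
  show "strict_mult n (strict_mult n A B) C i l = strict_mult n A (strict_mult n B C) i l"
  proof (cases "l \<le> n")
    case True
    have "strict_mult n (strict_mult n A B) C i l =
        (\<Sum>k\<in>{i<..<l}. \<Sum>j\<in>{j \<in> {i<..<l}. j < k}. A i j * B j k * C k l)"
      unfolding strict_mult_def using True
      by (auto simp: sum_distrib_right intro!: sum.cong)
    also have "\<dots> = (\<Sum>j\<in>{i<..<l}. \<Sum>k\<in>{k \<in> {i<..<l}. j < k}. A i j * B j k * C k l)"
      by (rule sum.swap_restrict) auto
    also have "\<dots> = strict_mult n A (strict_mult n B C) i l"
      unfolding strict_mult_def using True
      by (auto simp: sum_distrib_left mult.assoc intro!: sum.cong)
    finally show ?thesis .
  qed (simp add: strict_mult_def)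
qed

text \<open>
  A Schur multiplier acts on the matrix unit at \<open>(i, j)\<close> by the scalar \<open>s i j\<close>.  As the product of the units
  at \<open>(i, j)\<close> and \<open>(j, k)\<close> is the unit at \<open>(i, k)\<close>, the extended Rota-Baxter identity turns
  into one scalar equation for each triple \<open>i < j < k\<close>.
\<close>

lemma schur_extended_rota_baxter_algebra:
  fixes lam kap :: "'k::field"
  assumes s: "\<And>i j k. i < j \<Longrightarrow> j < k \<Longrightarrow> k \<le> n \<Longrightarrow>
    s i j * s j k = (s i j + s j k + lam) * s i k + kap"
  shows "extended_rota_baxter_algebra mat_scale (strict_mult n) (schur_mult s) lam kap"
proof unfold_locales
  fix A B :: "nat \<Rightarrow> nat \<Rightarrow> 'k"
  show "strict_mult n (schur_mult s A) (schur_mult s B) =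
      schur_mult s (strict_mult n A (schur_mult s B)) + schur_mult s (strict_mult n (schur_mult s A) B)
      + mat_scale lam (schur_mult s (strict_mult n A B)) + mat_scale kap (strict_mult n A B)"
  proof (intro ext)
    fix i k
    have "s i j * A i j * (s j k * B j k) = s i k * (A i j * (s j k * B j k))
        + s i k * (s i j * A i j * B j k) + lam * (s i k * (A i j * B j k)) + kap * (A i j * B j k)"
      if "j \<in> {i<..<k}" "k \<le> n" for j
    proof -
      have "s i j * A i j * (s j k * B j k) = (s i j * s j k) * (A i j * B j k)" by simp
      also have "s i j * s j k = (s i j + s j k + lam) * s i k + kap" using that by (intro s) auto
      finally show ?thesis by (simp add: algebra_simps)
    qed
    then show "strict_mult n (schur_mult s A) (schur_mult s B) i k =
      (schur_mult s (strict_mult n A (schur_mult s B)) + schur_mult s (strict_mult n (schur_mult s A) B)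
      + mat_scale lam (schur_mult s (strict_mult n A B)) + mat_scale kap (strict_mult n A B)) i k"
      by (simp add: strict_mult_def schur_mult_def mat_scale_def sum_distrib_left flip: sum.distrib)
  qed
next
  show "strict_mult n (strict_mult n A B) C = strict_mult n A (strict_mult n B C)" for A B C :: "nat \<Rightarrow> nat \<Rightarrow> 'k"
    by (rule strict_mult_assoc)
qed (auto simp: fun_eq_iff mat_scale_def strict_mult_def schur_mult_def algebra_simps
    sum.distrib sum_distrib_left)

text \<open>
  For distinct \<open>t\<^sub>i\<close>, the function \<open>s i j = (t\<^sub>i t\<^sub>j + \<lambda> t\<^sub>j + \<kappa>) / (t\<^sub>i - t\<^sub>j)\<close> satisfies the equations
  above; it is a form of the addition theorem of the cotangent.  Here \<open>t\<^sub>1\<close> is sent to infinity, which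
  makes \<open>s 0 1 = - t\<^sub>0 - \<lambda>\<close>, \<open>s 1 2 = t\<^sub>2\<close> and \<open>s 1 3 = t\<^sub>3\<close> free parameters \<open>p\<close>, \<open>q\<close>, \<open>v\<close>.
\<close>

definition spectrum :: "'k::field \<Rightarrow> 'k \<Rightarrow> 'k \<Rightarrow> 'k \<Rightarrow> 'k \<Rightarrow> nat \<Rightarrow> nat \<Rightarrow> 'k" where
  "spectrum lam kap p q v i j =
    (if (i, j) = (0, 1) then p
     else if (i, j) = (1, 2) then q
     else if (i, j) = (1, 3) then v
     else if (i, j) = (0, 2) then (p * q - kap) / (p + q + lam)
     else if (i, j) = (0, 3) then (p * v - kap) / (p + v + lam)
     else if (i, j) = (2, 3) then ((q + lam) * v + kap) / (q - v)
     else 0)"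

lemma spectrum_relation:
  fixes lam kap p q v :: "'k::field"
  assumes nz: "p + q + lam \<noteq> 0" "p + v + lam \<noteq> 0" "q \<noteq> v" and ijk: "i < j" "j < k" "k \<le> 3"
  defines "s \<equiv> spectrum lam kap p q v"
  shows "s i j * s j k = (s i j + s j k + lam) * s i k + kap"
proof -
  define u w r where "u = s 0 2" and "w = s 0 3" and "r = s 2 3"
  have u: "(p + q + lam) * u = p * q - kap" and w: "(p + v + lam) * w = p * v - kap"
    and r: "(q - v) * r = (q + lam) * v + kap"
    using nz by (simp_all add: u_def w_def r_def s_def spectrum_def)
  have "(p + q + lam) * (q - v) * (u + r + lam) =
      (p + q + lam) * u * (q - v) + (p + q + lam) * ((q - v) * r) + lam * (p + q + lam) * (q - v)"
    by (simp add: algebra_simps)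
  also have "\<dots> = (q * q + lam * q + kap) * (p + v + lam)"
    unfolding u r by (simp add: algebra_simps)
  finally have sum: "(p + q + lam) * (q - v) * (u + r + lam) = (q * q + lam * q + kap) * (p + v + lam)" .
  have "(p + q + lam) * (q - v) * ((u + r + lam) * w + kap) =
      (p + q + lam) * (q - v) * (u + r + lam) * w + kap * (p + q + lam) * (q - v)"
    by (simp add: algebra_simps)
  also have "\<dots> = (q * q + lam * q + kap) * ((p + v + lam) * w) + kap * (p + q + lam) * (q - v)"
    unfolding sum by (simp only: mult.assoc)
  also have "\<dots> = (p * q - kap) * ((q + lam) * v + kap)"
    unfolding w by (simp add: algebra_simps)
  also have "\<dots> = (p + q + lam) * (q - v) * (u * r)"
    unfolding u[symmetric] r[symmetric] by (simp add: algebra_simps)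
  finally have cocycle: "u * r = (u + r + lam) * w + kap" using nz by simp
  \<comment> \<open>The triples through the index \<open>1\<close> hold by the choice of \<open>u\<close>, \<open>w\<close>, \<open>r\<close>; only \<open>(0, 2, 3)\<close> needs the
    computation above.\<close>
  have "(i, j, k) \<in> {(0, 1, 2), (0, 1, 3), (0, 2, 3), (1, 2, 3)}" using ijk by auto
  moreover have "s 0 1 = p" "s 1 2 = q" "s 1 3 = v" by (simp_all add: s_def spectrum_def)
  ultimately show ?thesis
    using u w r cocycle by (auto simp: algebra_simps simp flip: u_def w_def r_def)
qed

section \<open>Solving for the coefficients of a relation\<close>

lemma cubic_coeffs_zero:
  fixes a b c d :: "'k::field_char_0"
  assumes "finite S" "\<And>x. x \<notin> S \<Longrightarrow> a + b * x + c * x ^ 2 + d * x ^ 3 = 0"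
  shows "a = 0 \<and> b = 0 \<and> c = 0 \<and> d = 0"
proof -
  have "- S \<subseteq> {x. poly [:a, b, c, d:] x = 0}"
    using assms(2) by (auto simp: algebra_simps power2_eq_square power3_eq_cube)
  moreover have "infinite (- S)"
    using assms(1) by (simp add: Compl_eq_Diff_UNIV infinite_UNIV_char_0 Diff_infinite_finite)
  ultimately have "[:a, b, c, d:] = 0" using poly_roots_finite finite_subset by blast
  then show ?thesis by simp
qed

text \<open>
  The hypothesis is the vanishing, on the matrix units of three consecutive diagonal positions, of the
  relation with the coefficients \<open>l1, \<dots>, l4\<close> and \<open>r1, \<dots>, r4\<close>, both in the order \<open>\<prec>\<otimes>\<prec>\<close>, \<open>\<prec>\<otimes>\<succ>\<close>, \<open>\<succ>\<otimes>\<prec>\<close>,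
  \<open>\<succ>\<otimes>\<succ>\<close>; \<open>u\<close> and \<open>r\<close> are the eigenvalues at \<open>(0, 2)\<close> and \<open>(2, 3)\<close>.  It is a rational identity in
  \<open>p\<close>, \<open>q\<close>, \<open>v\<close>, valid wherever the denominators do not vanish.  Clearing denominators and comparing
  coefficients, first in \<open>p\<close>, then in \<open>v\<close>, then in \<open>q\<close>, decouples the unknowns.
\<close>

lemma kernel_coefficients:
  fixes lam kap l1 l2 l3 l4 r1 r2 r3 r4 :: "'k::field_char_0"
  assumes H: "\<And>p q v u r. \<lbrakk>p + q + lam \<noteq> 0; p + v + lam \<noteq> 0; q \<noteq> v;
      u = (p * q - kap) / (p + q + lam); r = ((q + lam) * v + kap) / (q - v)\<rbrakk> \<Longrightarrow>
      l1 * (q * r) + l2 * (q * u) + l3 * (p * r) + l4 * (p * u)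
      = r1 * (r * v) + r2 * (q * v) + r3 * (p * r) + r4 * (p * q)"
  shows "r1 = l1 \<and> r2 = l1 \<and> r3 = l3 \<and> l2 = l4 \<and> r4 = l4 \<and>
    lam * l1 = 0 \<and> lam * l4 = 0 \<and> kap * (l1 - l4) = 0"
proof -
  \<comment> \<open>Multiplied by \<open>p + q + lam\<close>, the identity is quadratic in \<open>p\<close>; \<open>W\<close> collects the terms without \<open>p\<close>.\<close>
  have fixed_qv: "(l3 - r3) * r + (l4 - r4) * q = 0 \<and>
      W + ((l3 - r3) * r - r4 * q) * (q + lam) + l2 * q ^ 2 - l4 * kap = 0 \<and>
      W * (q + lam) - l2 * q * kap = 0"
    if "q \<noteq> v" "r = ((q + lam) * v + kap) / (q - v)" "W = l1 * q * r - r1 * r * v - r2 * q * v" for q v r W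
  proof -
    have *: "W * (q + lam) - l2 * q * kap + (W + ((l3 - r3) * r - r4 * q) * (q + lam) + l2 * q ^ 2 - l4 * kap) * p
        + ((l3 - r3) * r + (l4 - r4) * q) * p ^ 2 + 0 * p ^ 3 = 0" if p: "p \<notin> {- q - lam, - v - lam}" for p
    proof -
      define u where "u = (p * q - kap) / (p + q + lam)"
      have nz: "p + q + lam \<noteq> 0" "p + v + lam \<noteq> 0"
        using p by (auto simp: eq_diff_eq eq_neg_iff_add_eq_0 add_ac)
      have u: "u * (p + q + lam) - (p * q - kap) = 0" using nz by (simp add: u_def)
      have zero: "l1 * (q * r) + l2 * (q * u) + l3 * (p * r) + l4 * (p * u)
          - (r1 * (r * v) + r2 * (q * v) + r3 * (p * r) + r4 * (p * q)) = 0" (is "?h = 0")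
        using H[OF nz \<open>q \<noteq> v\<close> u_def \<open>r = _\<close>] by simp
      have "W * (q + lam) - l2 * q * kap + (W + ((l3 - r3) * r - r4 * q) * (q + lam) + l2 * q ^ 2 - l4 * kap) * p
        + ((l3 - r3) * r + (l4 - r4) * q) * p ^ 2 =
        (p + q + lam) * ?h - (l2 * q + l4 * p) * (u * (p + q + lam) - (p * q - kap))"
        unfolding \<open>W = _\<close> by (simp add: algebra_simps power2_eq_square)
      then show ?thesis unfolding zero u by simp
    qed
    have "finite {- q - lam, - v - lam}" by simp
    from cubic_coeffs_zero[OF this *] show ?thesis by blast
  qed
  \<comment> \<open>The coefficient of \<open>p ^ 2\<close>, multiplied by \<open>q - v\<close>, as a polynomial in \<open>v\<close>.\<close>
  have eqs: "(l3 - r3) * kap + (l4 - r4) * q ^ 2 = 0 \<and> (l3 - r3) * (q + lam) - (l4 - r4) * q = 0" for q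
  proof -
    have *: "(l3 - r3) * kap + (l4 - r4) * q ^ 2 + ((l3 - r3) * (q + lam) - (l4 - r4) * q) * v
        + 0 * v ^ 2 + 0 * v ^ 3 = 0" if v: "v \<notin> {q}" for v
    proof -
      define r where "r = ((q + lam) * v + kap) / (q - v)"
      have "q \<noteq> v" using v by auto
      then have r: "r * (q - v) - ((q + lam) * v + kap) = 0" by (simp add: r_def)
      have zero: "(l3 - r3) * r + (l4 - r4) * q = 0"
        using fixed_qv[OF \<open>q \<noteq> v\<close> r_def refl] by blast
      have "((l3 - r3) * kap + (l4 - r4) * q ^ 2 + ((l3 - r3) * (q + lam) - (l4 - r4) * q) * v) =
        (q - v) * ((l3 - r3) * r + (l4 - r4) * q) - (l3 - r3) * (r * (q - v) - ((q + lam) * v + kap))"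
        by (simp add: algebra_simps power2_eq_square)
      then show ?thesis unfolding zero r by simp
    qed
    have "finite {q}" by simp
    from cubic_coeffs_zero[OF this *] show ?thesis by blast
  qed
  have "r4 = l4" using eqs[of 0] eqs[of 1] by auto
  moreover have "r3 = l3"
    using eqs[of "1 - lam"] \<open>r4 = l4\<close> by simp
  ultimately have rest: "W - l4 * q * (q + lam) + l2 * q ^ 2 - l4 * kap = 0 \<and> W * (q + lam) - l2 * q * kap = 0"
    if "q \<noteq> v" "r = ((q + lam) * v + kap) / (q - v)" "W = l1 * q * r - r1 * r * v - r2 * q * v" for q v r W
    using fixed_qv[OF that] by (simp add: algebra_simps)
  \<comment> \<open>Eliminating \<open>W\<close> from the two remaining coefficients gives \<open>(q ^ 2 + lam * q + kap) * (l2 * q - l4 * (q + lam)) = 0\<close>,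
    here expanded in powers of \<open>q\<close>.\<close>
  have *: "- (l4 * lam * kap) + (l2 * kap - l4 * kap - l4 * lam ^ 2) * q
      + (l2 * lam - 2 * l4 * lam) * q ^ 2 + (l2 - l4) * q ^ 3 = 0" for q
  proof -
    obtain v where "q \<noteq> v" by (metis zero_neq_one)
    then obtain W where W: "W - l4 * q * (q + lam) + l2 * q ^ 2 - l4 * kap = 0" "W * (q + lam) - l2 * q * kap = 0"
      using rest[OF _ refl refl] by blast
    have "- (l4 * lam * kap) + (l2 * kap - l4 * kap - l4 * lam ^ 2) * q
        + (l2 * lam - 2 * l4 * lam) * q ^ 2 + (l2 - l4) * q ^ 3 =
        (q + lam) * (W - l4 * q * (q + lam) + l2 * q ^ 2 - l4 * kap) - (W * (q + lam) - l2 * q * kap)"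
      by (simp add: algebra_simps power2_eq_square power3_eq_cube)
    then show ?thesis unfolding W by simp
  qed
  have "l2 = l4" "l4 * lam = 0"
    using cubic_coeffs_zero[OF finite.emptyI *] by auto
  \<comment> \<open>What remains is \<open>W = l4 * kap\<close>; multiplied by \<open>q - v\<close>, it is again quadratic in \<open>v\<close>.\<close>
  have coeffs: "l1 * q * (q + lam) - r1 * kap - r2 * q ^ 2 + l4 * kap = 0 \<and> r2 * q - r1 * (q + lam) = 0" for q
  proof -
    have *: "(l1 * kap - l4 * kap) * q + (l1 * q * (q + lam) - r1 * kap - r2 * q ^ 2 + l4 * kap) * v
        + (r2 * q - r1 * (q + lam)) * v ^ 2 + 0 * v ^ 3 = 0" if v: "v \<notin> {q}" for v
    proof -
      define r where "r = ((q + lam) * v + kap) / (q - v)"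
      have "q \<noteq> v" using v by auto
      then have r: "r * (q - v) - ((q + lam) * v + kap) = 0" by (simp add: r_def)
      have "l4 * q * lam = 0" using \<open>l4 * lam = 0\<close> by auto
      then have zero: "l1 * q * r - r1 * r * v - r2 * q * v - l4 * kap = 0"
        using rest[OF \<open>q \<noteq> v\<close> r_def refl] \<open>l2 = l4\<close> by (simp add: algebra_simps power2_eq_square)
      have "(l1 * kap - l4 * kap) * q + (l1 * q * (q + lam) - r1 * kap - r2 * q ^ 2 + l4 * kap) * v
          + (r2 * q - r1 * (q + lam)) * v ^ 2 =
          (q - v) * (l1 * q * r - r1 * r * v - r2 * q * v - l4 * kap)
          - (l1 * q - r1 * v) * (r * (q - v) - ((q + lam) * v + kap))"
        by (simp add: algebra_simps power2_eq_square)
      then show ?thesis unfolding zero r by simp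
    qed
    have "finite {q}" by simp
    from cubic_coeffs_zero[OF this *] show ?thesis by blast
  qed
  have "r1 * lam = 0" using coeffs[of 0] by simp
  moreover have "r2 = r1" using coeffs[of 1] \<open>r1 * lam = 0\<close> by (simp add: algebra_simps)
  moreover have *: "(l4 * kap - r1 * kap) + l1 * lam * q + (l1 - r2) * q ^ 2 + 0 * q ^ 3 = 0" for q
    using coeffs[of q] by (simp add: algebra_simps power2_eq_square)
  moreover have "r1 = l1 \<and> l4 * kap = l1 * kap"
    using cubic_coeffs_zero[OF finite.emptyI *] \<open>r2 = r1\<close> by auto
  ultimately show ?thesis
    using \<open>r3 = l3\<close> \<open>r4 = l4\<close> \<open>l2 = l4\<close> \<open>l4 * lam = 0\<close> by (auto simp: algebra_simps)
qed

section \<open>The di-companion homomorphism in arity three\<close>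

lemma lin_ext_diff: "lin_ext f (x - y) = lin_ext f x - lin_ext f y"
  using lin_ext_add[of f x "- y"] lin_ext_scale[of f "-1" y] by (simp add: pm_scale_minus)

context ns_operad_ideal
begin

lemma cls_eq_zero_iff:
  assumes "x \<in> carrier (component P n)"
  shows "cls n x = \<zero>\<^bsub>component QP n\<^esub> \<longleftrightarrow> x \<in> I n"
proof -
  interpret module ring_of_type_algebra "component P n" by (rule component_module)
  have zero: "\<zero>\<^bsub>component QP n\<^esub> = I n" by (simp add: quotient_operad_def)
  show ?thesis
  proof
    assume "cls n x = \<zero>\<^bsub>component QP n\<^esub>"
    then show "x \<in> I n" using self_cls[OF assms] zero by simp
  next
    assume "x \<in> I n"
    then have "cls n x = cls n \<zero>\<^bsub>component P n\<^esub>"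
      by (intro cls_eqI[OF zero_closed _ r_zero[OF assms, symmetric]])
    then show "cls n x = \<zero>\<^bsub>component QP n\<^esub>" by (simp only: cls_zero)
  qed
qed

text \<open>
  The di-companion homomorphism into a quotient factors through the projection, by the
  uniqueness part of the universal property.  This moves the computation of the kernel into a free
  operad, where it becomes membership in an ideal.
\<close>

lemma dc_hom_quotient:
  assumes "r \<in> carrier (component P 1)" "m \<in> carrier (component P 2)"
    and x: "x \<in> carrier (component free_binary n)"
  shows "dc_hom QP (cls 1 r) (cls 2 m) n x = cls n (dc_hom P r m n x)"
proof -
  let ?h = "dc_hom P r m"
  have hom: "operad_hom free_binary P ?h"
    and gen: "?h 2 (free_gen (\<lambda>_. 2) Prec) = pcomp P 2 1 2 m r" "?h 2 (free_gen (\<lambda>_. 2) Succ) = pcomp P 2 1 1 m r"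
    using dc_hom_unique(1)[OF ns_operad_axioms assms(1,2)] by (auto simp: is_dc_hom_def)
  have closed: "?h k y \<in> carrier (component P k)" if "y \<in> carrier (component free_binary k)" for k y
    using hom that by (auto simp: operad_hom_def)
  have "cls (k + l - 1) (?h (k + l - 1) (pcomp free_binary k l i y z)) = pcomp QP k l i (cls k (?h k y)) (cls l (?h l z))"
    if "y \<in> carrier (component free_binary k)" "z \<in> carrier (component free_binary l)" "1 \<le> i" "i \<le> k" for k l i y z
  proof -
    have "?h (k + l - 1) (pcomp free_binary k l i y z) = pcomp P k l i (?h k y) (?h l z)"
      using hom that unfolding operad_hom_def by blast
    then show ?thesis by (simp only: cls_pcomp[OF closed[OF that(1)] closed[OF that(2)] that(3,4)])
  qed
  then have "operad_hom free_binary QP (\<lambda>k y. cls k (?h k y))"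
    using hom unfolding operad_hom_def by (auto simp: cls_in_carrier cls_add cls_smult cls_id)
  moreover have "cls 2 (?h 2 (free_gen (\<lambda>_. 2) Prec)) = pcomp QP 2 1 2 (cls 2 m) (cls 1 r)"
    "cls 2 (?h 2 (free_gen (\<lambda>_. 2) Succ)) = pcomp QP 2 1 1 (cls 2 m) (cls 1 r)"
    using cls_pcomp[OF assms(2,1), of 1] cls_pcomp[OF assms(2,1), of 2] by (simp_all add: gen)
  ultimately have "is_dc_hom QP (cls 1 r) (cls 2 m) (\<lambda>k y. cls k (?h k y))"
    by (simp only: is_dc_hom_def simp_thms)
  from dc_hom_unique(2)[OF quotient_ns_operad cls_in_carrier[OF assms(1)] cls_in_carrier[OF assms(2)] this x]
  show ?thesis by simp
qed

end

lemma operad_hom_free_lin_ext: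
  assumes hom: "operad_hom (free_operad ar) (free_operad ar') f" and x: "x \<in> carrier (component (free_operad ar) n)"
  shows "f n x = lin_ext (\<lambda>t. f n (basis_vec t)) x"
proof -
  have f_add: "f n (y + z) = f n y + f n z"
    if "y \<in> carrier (component (free_operad ar) n)" "z \<in> carrier (component (free_operad ar) n)" for y z
    using hom that by (auto simp: operad_hom_def free_operad_simps(2))
  have f_scale: "f n (pm_scale c y) = pm_scale c (f n y)" if "y \<in> carrier (component (free_operad ar) n)" for y c
    using hom that by (auto simp: operad_hom_def free_operad_simps(4))
  have "Poly_Mapping.keys x \<subseteq> {t. wf_tree ar t \<and> leaves t = n}"
    using x by (simp add: free_operad_simps)
  then show ?thesis
  proof (induction rule: lin_comb_induct)
    case zero
    have "f n (pm_scale 0 0) = pm_scale 0 (f n 0)" by (rule f_scale) (simp add: free_operad_simps)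
    then show ?case by simp
  next
    case (add c t y)
    then have t: "basis_vec t \<in> carrier (component (free_operad ar) n)"
      and y: "y \<in> carrier (component (free_operad ar) n)"
      by (auto simp: free_operad_simps)
    show ?case
      using f_add[OF free_scale_closed[OF t] y, of c] f_scale[OF t, of c] add.IH
      by (simp add: lin_ext_add lin_ext_scale)
  qed
qed

text \<open>
  The images of \<open>\<prec>\<close> and \<open>\<succ>\<close> under \<open>\<Psi>\<close>, lifted to the free operad.
\<close>

primrec dend_tree :: "dend \<Rightarrow> rb ptree" where
  "dend_tree Prec = Node Mu [Leaf, Node Rho [Leaf]]"
| "dend_tree Succ = Node Mu [Node Rho [Leaf], Leaf]"

text \<open>
  The lift of \<open>\<Psi>(relator w)\<close> to the free operad obtained by replacing every vertex of the relation
  by its tree.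
\<close>

definition rb_relator :: "(dend, 'k::field) quadratic \<Rightarrow> (rb ptree \<Rightarrow>\<^sub>0 'k)" where
  "rb_relator w =
    lin_ext (\<lambda>(p, q). basis_vec (graft (dend_tree q) 1 (dend_tree p))) (fst w)
    - lin_ext (\<lambda>(p, q). basis_vec (graft (dend_tree p) 2 (dend_tree q))) (snd w)"

lemma dc_hom_free_relator: "dc_hom free_rb rho mu 3 (relator w) = rb_relator w"
proof -
  let ?h = "dc_hom free_rb rho mu :: nat \<Rightarrow> (dend ptree \<Rightarrow>\<^sub>0 'a) \<Rightarrow> _"
  have "is_dc_hom free_rb rho mu ?h"
    by (intro dc_hom_unique(1) free_operad_ns_operad free_gen_closed) simp_all
  then have hom: "operad_hom free_binary free_rb ?h"
    and "?h 2 (free_gen (\<lambda>_. 2) Prec) = pcomp free_rb 2 1 2 mu rho"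
    "?h 2 (free_gen (\<lambda>_. 2) Succ) = pcomp free_rb 2 1 1 mu rho"
    by (auto simp: is_dc_hom_def)
  then have gen: "?h 2 (free_gen (\<lambda>_. 2) g) = basis_vec (dend_tree g)" for g
    by (cases g) (simp_all add: free_gen_def numeral_2_eq_2)
  have pcomp: "?h (k + l - 1) (pcomp free_binary k l i x y) = pcomp free_rb k l i (?h k x) (?h l y)"
    if "1 \<le> i" "i \<le> k" "x \<in> carrier (component free_binary k)" "y \<in> carrier (component free_binary l)"
    for k l i x y
    using hom that unfolding operad_hom_def by blast
  have "?h 3 (pcomp free_binary 2 2 i (free_gen (\<lambda>_. 2) g) (free_gen (\<lambda>_. 2) g')) =
      basis_vec (graft (dend_tree g) i (dend_tree g'))" if "1 \<le> i" "i \<le> 2" for i g g'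
  proof -
    have "?h (2 + 2 - 1) (pcomp free_binary 2 2 i (free_gen (\<lambda>_. 2) g) (free_gen (\<lambda>_. 2) g')) =
        pcomp free_rb 2 2 i (?h 2 (free_gen (\<lambda>_. 2) g)) (?h 2 (free_gen (\<lambda>_. 2) g'))"
      by (intro pcomp that free_gen_closed refl)
    then show ?thesis by (simp add: gen)
  qed
  from this[of 1] this[of 2]
  have "?h 3 (basis_vec (Node q [Node p [Leaf, Leaf], Leaf])) = basis_vec (graft (dend_tree q) 1 (dend_tree p))"
    "?h 3 (basis_vec (Node p [Leaf, Node q [Leaf, Leaf]])) = basis_vec (graft (dend_tree p) 2 (dend_tree q))" for p q
    by (simp_all add: free_gen_def numeral_2_eq_2)
  then show ?thesis
    unfolding operad_hom_free_lin_ext[OF hom relator_closed]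
    unfolding relator_eq rb_relator_def lin_ext_diff lin_ext_lin_ext
    by (simp add: case_prod_unfold)
qed

lemma dc_hom_ERB_relator_eq_zero_iff:
  "dc_hom (ERB lam kap) (ERB_rho lam kap) (ERB_mu lam kap) 3 (relator w) = \<zero>\<^bsub>component (ERB lam kap) 3\<^esub>
    \<longleftrightarrow> rb_relator w \<in> ERB_ideal lam kap 3"
proof -
  interpret ns_operad_ideal free_rb "ERB_ideal lam kap"
    by (intro ns_operad_ideal.intro ns_operad_ideal_axioms.intro free_operad_ns_operad ERB_ideal)
  have gen: "rho \<in> carrier (component free_rb 1)" "mu \<in> carrier (component free_rb 2)"
    by (simp_all add: free_gen_closed)
  have "dc_hom free_rb rho mu 3 (relator w) \<in> carrier (component free_rb 3)"
    using dc_hom_unique(1)[OF free_operad_ns_operad gen] relator_closed[of w]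
    by (auto simp: is_dc_hom_def operad_hom_def)
  then show ?thesis
    unfolding ERB_def ERB_rho_def ERB_mu_def dc_hom_quotient[OF gen relator_closed]
    by (simp only: cls_eq_zero_iff dc_hom_free_relator)
qed

lemma lin_ext_dend_pairs:
  "lin_ext f x = pm_scale (Poly_Mapping.lookup x (Prec, Prec)) (f (Prec, Prec))
    + pm_scale (Poly_Mapping.lookup x (Prec, Succ)) (f (Prec, Succ))
    + pm_scale (Poly_Mapping.lookup x (Succ, Prec)) (f (Succ, Prec))
    + pm_scale (Poly_Mapping.lookup x (Succ, Succ)) (f (Succ, Succ))"
proof -
  let ?S = "{(Prec, Prec), (Prec, Succ), (Succ, Prec), (Succ, Succ)}"
  have "y \<in> ?S" for y :: "dend \<times> dend"
    by (cases y; cases "fst y"; cases "snd y") auto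
  then have "lin_ext f x = (\<Sum>b\<in>?S. pm_scale (Poly_Mapping.lookup x b) (f b))"
    by (intro lin_ext_superset) auto
  then show ?thesis by (simp add: add.assoc)
qed

section \<open>The relations of extended dendriform algebras\<close>

text \<open>
  Modulo the ideal, \<open>x\<rho>(y)\<rho>(z)\<close> is \<open>x\<rho>(y\<rho>(z)) + x\<rho>(\<rho>(y)z) + \<lambda>x\<rho>(yz) + \<kappa>xyz\<close>, and \<open>\<rho>(x)\<rho>(y)z\<close> expands in the
  same way.  So the relations with coefficients \<open>a\<close> and \<open>c\<close> hold up to the defects \<open>\<lambda>a\<close>, \<open>\<lambda>c\<close> and
  \<open>\<kappa>(a - c)\<close>, the last one because both \<open>\<kappa>\<close>-terms are multiples of \<open>xyz\<close>.  The relation with coefficient \<open>b\<close>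
  is associativity alone.
\<close>

lemma rb_relator_ED_in_ideal:
  assumes "w \<in> ED_relations lam kap"
  shows "rb_relator w \<in> ERB_ideal lam kap 3"
proof -
  let ?I = "ERB_ideal lam kap"
  obtain a b c where w: "w = quad_scale a (tensor prec prec, tensor prec star)
     + quad_scale b (tensor succ prec, tensor succ prec)
     + quad_scale c (tensor star succ, tensor succ succ)"
    and abc: "lam * a = 0" "lam * c = 0" "kap * (a - c) = 0"
    using assms by (auto simp: ED_relations_def)
  interpret ns_operad_ideal free_rb ?I
    by (intro ns_operad_ideal.intro ns_operad_ideal_axioms.intro free_operad_ns_operad ERB_ideal)
  interpret F: module "ring_of_type_algebra :: 'a ring" "component free_rb 3"
    by (rule free_operad_module)
  have add: "x + y \<in> ?I 3" if "x \<in> ?I 3" "y \<in> ?I 3" for x y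
    using F.submoduleE(5)[OF sub that] by (simp add: free_operad_simps(2))
  have scale: "pm_scale d x \<in> ?I 3" if "x \<in> ?I 3" for x d
    using F.submoduleE(4)[OF sub UNIV_K that] by (simp add: free_operad_simps(4))
  have gen: "rho \<in> carrier (component free_rb 1)" "mu \<in> carrier (component free_rb 2)"
    by (simp_all add: free_gen_closed)
  have assoc: "assoc_relator \<in> ?I 3" and erb: "ERB_relator lam kap \<in> ?I 2"
    using operad_ideal_gen_subset[of "\<lambda>n. if n = 2 then {ERB_relator lam kap} else if n = 3 then {assoc_relator} else {}" 3 free_rb]
      operad_ideal_gen_subset[of "\<lambda>n. if n = 2 then {ERB_relator lam kap} else if n = 3 then {assoc_relator} else {}" 2 free_rb]
    by (auto simp: ERB_ideal_def)
  have rho_at: "pcomp free_rb 3 1 i x rho \<in> ?I 3" if "x \<in> ?I 3" "1 \<le> i" "i \<le> 3" for x i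
    using ideal_left[OF that(2,3,1) gen(1)] by simp
  have mu_erb: "pcomp free_rb 2 2 i mu (ERB_relator lam kap) \<in> ?I 3" if "1 \<le> i" "i \<le> 2" for i
    using ideal_right[OF that gen(2) erb] by simp
  let ?assoc = "\<lambda>i j. pcomp free_rb 3 1 j (pcomp free_rb 3 1 i assoc_relator rho) rho"
  let ?erb = "\<lambda>i. pcomp free_rb 2 2 i mu (ERB_relator lam kap)"
  \<comment> \<open>The last summand rebrackets \<open>(xy)z\<close>, so that the two \<open>\<kappa>\<close>-terms cancel.\<close>
  have "rb_relator w = pm_scale a (?assoc 2 3) + pm_scale a (?erb 2) + pm_scale b (?assoc 1 3)
      + pm_scale c (?assoc 1 2) + pm_scale (- c) (?erb 1) + pm_scale (- (a * kap)) assoc_relator"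
  proof (rule poly_mapping_eqI)
    fix t
    have "a * (lam * z) = 0" "c * (lam * z) = 0" "c * (kap * z) = a * (kap * z)" for z
      using abc by auto
    then have abc': "a * (lam * z) = 0" "lam * (a * z) = 0" "c * (lam * z) = 0" "lam * (c * z) = 0"
      "c * (kap * z) = a * (kap * z)" "kap * (c * z) = kap * (a * z)" for z
      by (simp_all add: mult.left_commute)
    show "Poly_Mapping.lookup (rb_relator w) t = Poly_Mapping.lookup (pm_scale a (?assoc 2 3) + pm_scale a (?erb 2) + pm_scale b (?assoc 1 3)
      + pm_scale c (?assoc 1 2) + pm_scale (- c) (?erb 1) + pm_scale (- (a * kap)) assoc_relator) t"
      unfolding w rb_relator_def assoc_relator_def ERB_relator_def
      by (simp add: free_operad_simps(5) free_gen_def numeral_2_eq_2 numeral_3_eq_3 tensor_def quad_scale_def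
        lin_ext_add lin_ext_diff lin_ext_scale lookup_add lookup_minus)
        (simp add: algebra_simps abc')
  qed
  moreover have "\<dots> \<in> ?I 3"
    by (intro add scale rho_at mu_erb assoc) simp_all
  ultimately show ?thesis by simp
qed

text \<open>
  Indexed by the row alone, the units at \<open>(i, i + 1)\<close> form the sequence of inputs on which relations of arity
  three are evaluated: \<open>x\<close>, \<open>y\<close>, \<open>z\<close> are the units at \<open>(0, 1)\<close>, \<open>(1, 2)\<close>, \<open>(2, 3)\<close>, whose product is the unit at \<open>(0, 3)\<close>.
\<close>

definition mat_unit :: "nat \<Rightarrow> nat \<Rightarrow> nat \<Rightarrow> 'k::field" where
  "mat_unit i = (\<lambda>j k. if j = i \<and> k = Suc i then 1 else 0)"

lemma strict_mult_3:
  "strict_mult 3 A B 0 (Suc 0) = 0" "strict_mult 3 A B (Suc 0) 2 = 0" "strict_mult 3 A B 2 3 = 0"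
  "strict_mult 3 A B 0 2 = A 0 (Suc 0) * B (Suc 0) 2"
  "strict_mult 3 A B (Suc 0) 3 = A (Suc 0) 2 * B 2 3"
  "strict_mult 3 A B 0 3 = A 0 (Suc 0) * B (Suc 0) 3 + A 0 2 * B 2 3"
proof -
  have "{0<..<Suc 0} = {}" "{Suc 0<..<2} = {}" "{2<..<3::nat} = {}" "{0<..<2} = {Suc 0}"
    "{Suc 0<..<3} = {2}" "{0<..<3} = {Suc 0, 2}"
    by auto
  then show "strict_mult 3 A B 0 (Suc 0) = 0" "strict_mult 3 A B (Suc 0) 2 = 0" "strict_mult 3 A B 2 3 = 0"
    "strict_mult 3 A B 0 2 = A 0 (Suc 0) * B (Suc 0) 2"
    "strict_mult 3 A B (Suc 0) 3 = A (Suc 0) 2 * B 2 3"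
    "strict_mult 3 A B 0 3 = A 0 (Suc 0) * B (Suc 0) 3 + A 0 2 * B 2 3"
    by (simp_all add: strict_mult_def)
qed

lemma lookup_basis_vec: "Poly_Mapping.lookup (basis_vec b) k = (if b = k then 1 else 0)"
  by (simp add: basis_vec_def lookup_single)

text \<open>
  On the three consecutive matrix units, the value of a tree is a multiple of the unit at \<open>(0, 3)\<close>: a
  vertex \<open>\<rho>\<close> whose inputs multiply to the unit at \<open>(i, j)\<close> contributes the factor \<open>s i j\<close>.  The vanishing of
  the relation for all choices of the spectrum determines the coefficients.
\<close>

lemma ED_if_rb_relator_in_ideal:
  fixes lam kap :: "'k::field_char_0"
  assumes "rb_relator w \<in> ERB_ideal lam kap 3"
  shows "w \<in> ED_relations lam kap"
proof -
  let ?l = "\<lambda>p q. Poly_Mapping.lookup (fst w) (p, q)" and ?r = "\<lambda>p q. Poly_Mapping.lookup (snd w) (p, q)"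
  have coeffs: "?r Prec Prec = ?l Prec Prec \<and> ?r Prec Succ = ?l Prec Prec \<and> ?r Succ Prec = ?l Succ Prec \<and>
      ?l Prec Succ = ?l Succ Succ \<and> ?r Succ Succ = ?l Succ Succ \<and>
      lam * ?l Prec Prec = 0 \<and> lam * ?l Succ Succ = 0 \<and> kap * (?l Prec Prec - ?l Succ Succ) = 0"
  proof (rule kernel_coefficients)
    fix p q v u r
    assume nz: "p + q + lam \<noteq> 0" "p + v + lam \<noteq> 0" "q \<noteq> v"
      and u: "u = (p * q - kap) / (p + q + lam)" and r: "r = ((q + lam) * v + kap) / (q - v)"
    let ?s = "spectrum lam kap p q v"
    have s: "?s 0 (Suc 0) = p" "?s (Suc 0) 2 = q" "?s (Suc 0) 3 = v" "?s 0 2 = u" "?s 2 3 = r"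
      by (simp_all add: spectrum_def u r)
    interpret extended_rota_baxter_algebra mat_scale "strict_mult 3" "schur_mult ?s" lam kap
      by (intro schur_extended_rota_baxter_algebra spectrum_relation nz)
    have "op_eval (rb_relator w) mat_unit 0 3 = 0"
      using assms ERB_ideal_subset_identities[of 3] by (auto simp: identities_def)
    then show "?l Prec Prec * (q * r) + ?l Prec Succ * (q * u) + ?l Succ Prec * (p * r) + ?l Succ Succ * (p * u)
      = ?r Prec Prec * (r * v) + ?r Prec Succ * (q * v) + ?r Succ Prec * (p * r) + ?r Succ Succ * (p * q)"
      by (simp add: rb_relator_def lin_ext_dend_pairs op_eval_diff op_eval_add op_eval_scale mat_scale_def
        schur_mult_def strict_mult_3 s mat_unit_def numeral_2_eq_2[symmetric] algebra_simps)
  qed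
  let ?a = "?l Prec Prec" and ?b = "?l Succ Prec" and ?c = "?l Succ Succ"
  have "w = quad_scale ?a (tensor prec prec, tensor prec star)
     + quad_scale ?b (tensor succ prec, tensor succ prec)
     + quad_scale ?c (tensor star succ, tensor succ succ)" (is "w = ?w")
  proof (rule prod_eqI; rule poly_mapping_eqI)
    fix g :: "dend \<times> dend"
    obtain p q where g: "g = (p, q)" by (cases g)
    show "Poly_Mapping.lookup (fst w) g = Poly_Mapping.lookup (fst ?w) g"
      using coeffs unfolding g
      by (cases p; cases q) (simp_all add: quad_scale_def tensor_def lin_ext_add lookup_add lookup_basis_vec)
    show "Poly_Mapping.lookup (snd w) g = Poly_Mapping.lookup (snd ?w) g"
      using coeffs unfolding g
      by (cases p; cases q) (simp_all add: quad_scale_def tensor_def lin_ext_add lookup_add lookup_basis_vec)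
  qed
  then show ?thesis unfolding ED_relations_def using coeffs by blast
qed

lemma quadratic_kernel_dc_hom_ERB:
  fixes lam kap :: "'k::field_char_0"
  shows "quadratic_kernel (ERB lam kap) (dc_hom (ERB lam kap) (ERB_rho lam kap) (ERB_mu lam kap)) =
    ED_relations lam kap"
  using rb_relator_ED_in_ideal[of _ lam kap] ED_if_rb_relator_in_ideal[of _ lam kap]
  by (auto simp: quadratic_kernel_def a_kernel_def kernel_def relator_closed dc_hom_ERB_relator_eq_zero_iff)

theorem theorem4p8:
  fixes lam kap :: "'k::field_char_0"
  shows "ED lam kap = DC (ERB lam kap) (ERB_rho lam kap) (ERB_mu lam kap) \<and>
    is_dc_hom (ERB lam kap) (ERB_rho lam kap) (ERB_mu lam kap)
      (dc_hom (ERB lam kap) (ERB_rho lam kap) (ERB_mu lam kap)) \<and>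
    (\<forall>\<Psi>. is_dc_hom (ERB lam kap) (ERB_rho lam kap) (ERB_mu lam kap) \<Psi> \<longrightarrow>
      quadratic_kernel (ERB lam kap) \<Psi> = ED_relations lam kap)"
proof (intro conjI allI impI)
  note closed = ERB_ns_operad ERB_gen_closed
  show "ED lam kap = DC (ERB lam kap) (ERB_rho lam kap) (ERB_mu lam kap)"
    by (simp add: ED_def DC_def quadratic_kernel_dc_hom_ERB)
  show "is_dc_hom (ERB lam kap) (ERB_rho lam kap) (ERB_mu lam kap)
      (dc_hom (ERB lam kap) (ERB_rho lam kap) (ERB_mu lam kap))"
    by (rule dc_hom_unique(1)[OF closed])
  show "quadratic_kernel (ERB lam kap) \<Psi> = ED_relations lam kap"
    if "is_dc_hom (ERB lam kap) (ERB_rho lam kap) (ERB_mu lam kap) \<Psi>" for \<Psi>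
  proof -
    have "\<Psi> 3 (relator w) = dc_hom (ERB lam kap) (ERB_rho lam kap) (ERB_mu lam kap) 3 (relator w)" for w
      by (rule dc_hom_unique(2)[OF closed that relator_closed])
    then show ?thesis
      unfolding quadratic_kernel_dc_hom_ERB[symmetric]
      by (auto simp: quadratic_kernel_def a_kernel_def kernel_def relator_closed)
  qed
qed

end
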